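(* Let $n\ge 3$ be an integer, $\theta\in(0,\pi]$, $f_0>0$, $B\in\mathbb{R}$, $T\subset[-1,\cos\theta]$, $g:T\to\mathbb{R}$, and let $F\in\mathcal{F}(n,f_0,T,g,B,\theta)$. Let $a>0$ and suppose $g(t)\le a$ for all $t\in T$. Then for every $(N,n,\theta)$ spherical code $C$, $$A(T)\ge\frac{2}{N}\lceil R\rceil,\qquad R:=\frac{f_0N^2-F(1,1,1)-3(N-1)B}{6a},$$ where $A(T)$ is the distance-distribution sum of $C$ over $T$.
   Context: Spherical codes. An $(N,n,\theta)$ spherical code is an $N$-element subset $C$ ($N\ge1$) of the unit sphere $\mathbb{S}^{n-1}\subset\mathbb{R}^n$ such that $c\cdot c'\le\cos\theta$ for all distinct $c,c'\in C$. Distance distribution. For $u\in C$ and $-1\le t\le1$ let $A_t(u)=|\{v\in C: v\cdot u=t\}|$ and $A_t=\frac1N\sum_{u\in C}A_t(u)$. For $T\subset[-1,1]$ let $A(T)=\sum_{t\in T:\,A_t>0}A_t$ (a finite sum). Matrices $S_k^n$. Let $P_k^{n-1}$ denote the Gegenbauer polynomial of degree $k$ for dimension $n-1$, i.e. the polynomials orthogonal on $[-1,1]$ with respect to the weight $(1-t^2)^{(n-4)/2}$, normalized by $P_k^{n-1}(1)=1$. Fix $d\ge0$. For $0\le k\le d$ let $Y_k^n(x,y,z)$ be the $(d-k+1)\times(d-k+1)$ matrix with entries, indexed by $0\le i,j\le d-k$, $$\bigl(Y_k^n\bigr)_{ij}(x,y,z)=x^iy^j\bigl((1-x^2)(1-y^2)\bigr)^{k/2}P_k^{n-1}\!\left(\frac{z-xy}{\sqrt{(1-x^2)(1-y^2)}}\right),$$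 (which is a polynomial in $x,y,z$), and let $S_k^n(x,y,z)=\frac16\sum_{\sigma}Y_k^n(\sigma(x,y,z))$, the sum being over all $6$ permutations $\sigma$ of the variables $(x,y,z)$. Write $\langle A,B\rangle=\operatorname{tr}(A^{T}B)$. Class $\mathrm{BV}(n,f_0)$. For $f_0>0$, $\mathrm{BV}(n,f_0)$ is the class of symmetric real polynomials $F(x,y,z)$ that can be written (for some $d$) as $F(x,y,z)=\sum_{k=0}^d\langle M_k,S_k^n(x,y,z)\rangle$ with all $M_k$ real symmetric positive semidefinite and $M_0-f_0E_0$ positive semidefinite, where $E_0$ is the matrix whose only nonzero entry is a $1$ in the top left corner (index $(0,0)$). Class $\mathcal{F}$. For $g:T\to\mathbb{R}$ with $T\subset[-1,1)$, put $g_T(x)=g(x)$ if $x\in T$ and $g_T(x)=0$ otherwise. Let $$D(\theta)=\{(x,y,z): -1\le x,y,z\le\cos\theta,\ 1+2xyz-x^2-y^2-z^2\ge0\}.$$ $\mathcal{F}(n,f_0,T,g,B,\theta)$ is the class of symmetric polynomials $F(x,y,z)$ such that: (1) $F\in\mathrm{BV}(n,f_0)$; (2) $F(x,x,1)\le B+2g_T(x)$ for all $x\in[-1,\cos\theta]$; (3) $F(x,y,z)\le g_T(x)+g_T(y)+g_T(z)$ for all $(x,y,z)\in D(\theta)$. *)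

theory Defs
  imports
    "HOL-Analysis.Analysis"
    "HOL-Computational_Algebra.Polynomial"
    "Jordan_Normal_Form.Matrix"
begin

(* "\<bullet>" is the inner product of HOL-Analysis throughout; matrices are those of
   Jordan_Normal_Form, because their size d - k + 1 varies inside the definitions. *)
no_notation scalar_prod (infix \<open>\<bullet>\<close> 70)

definition spherical_code :: "nat \<Rightarrow> real \<Rightarrow> (real ^ 'n) set \<Rightarrow> bool" where
  "spherical_code N \<theta> C \<longleftrightarrow>
     N \<ge> 1 \<and> finite C \<and> card C = N \<and> C \<subseteq> sphere 0 1 \<and>
     (\<forall>c\<in>C. \<forall>c'\<in>C. c \<noteq> c' \<longrightarrow> c \<bullet> c' \<le> cos \<theta>)"

definition dist_distr_at :: "(real ^ 'n) set \<Rightarrow> (real ^ 'n) \<Rightarrow> real \<Rightarrow> nat" where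
  "dist_distr_at C u t = card {v \<in> C. v \<bullet> u = t}"

definition dist_distr :: "(real ^ 'n) set \<Rightarrow> real \<Rightarrow> real" where
  "dist_distr C t = (1 / real (card C)) * (\<Sum>u\<in>C. real (dist_distr_at C u t))"

definition dist_distr_sum :: "(real ^ 'n) set \<Rightarrow> real set \<Rightarrow> real" where
  "dist_distr_sum C T = (\<Sum>t\<in>{t \<in> T. dist_distr C t > 0}. dist_distr C t)"

(* Gegenbauer polynomials for dimension m, normalised by the value 1 at 1. They exist and are
   unique whenever the weight is integrable, i.e. for m \<ge> 2. The convention 0 powr a = 0 changes
   the weight only at the endpoints, a null set. *)
definition gegenbauer :: "nat \<Rightarrow> nat \<Rightarrow> real poly" where
  "gegenbauer m = (THE P.
     (\<forall>k. degree (P k) = k \<and> poly (P k) 1 = 1) \<and>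
     (\<forall>j k. j \<noteq> k \<longrightarrow>
        (LINT t:{-1..1}|lborel.
           poly (P j) t * poly (P k) t * (1 - t\<^sup>2) powr ((real m - 3) / 2)) = 0))"

(* The defining formula makes literal sense only where (1 - x^2) (1 - y^2) > 0. The entry is the
   polynomial in x, y, z given by that formula; as two polynomials agreeing on a nonempty open set
   are equal, it is determined by its values for |x| < 1 and |y| < 1. It exists because P_k has
   the parity of k. *)
definition Y_entry :: "nat \<Rightarrow> nat \<Rightarrow> nat \<Rightarrow> nat \<Rightarrow> real \<times> real \<times> real \<Rightarrow> real" where
  "Y_entry n k i j = (THE Y.
     real_polynomial_function Y \<and>
     (\<forall>x y z. \<bar>x\<bar> < 1 \<and> \<bar>y\<bar> < 1 \<longrightarrow>
        Y (x, y, z) =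
          x ^ i * y ^ j * ((1 - x\<^sup>2) * (1 - y\<^sup>2)) powr (real k / 2) *
          poly (gegenbauer (n - 1) k) ((z - x * y) / sqrt ((1 - x\<^sup>2) * (1 - y\<^sup>2)))))"

definition Y_mat :: "nat \<Rightarrow> nat \<Rightarrow> nat \<Rightarrow> real \<times> real \<times> real \<Rightarrow> real mat" where
  "Y_mat n d k p = mat (d - k + 1) (d - k + 1) (\<lambda>(i, j). Y_entry n k i j p)"

definition S_mat :: "nat \<Rightarrow> nat \<Rightarrow> nat \<Rightarrow> real \<times> real \<times> real \<Rightarrow> real mat" where
  "S_mat n d k = (\<lambda>(x, y, z). (1 / 6) \<cdot>\<^sub>m
     (Y_mat n d k (x, y, z) + Y_mat n d k (x, z, y) + Y_mat n d k (y, x, z) +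
      Y_mat n d k (y, z, x) + Y_mat n d k (z, x, y) + Y_mat n d k (z, y, x)))"

definition mat_trace :: "real mat \<Rightarrow> real" where
  "mat_trace A = (\<Sum>i<dim_row A. A $$ (i, i))"

definition mat_inner :: "real mat \<Rightarrow> real mat \<Rightarrow> real" where
  "mat_inner A B = mat_trace (transpose_mat A * B)"

definition psd_mat :: "nat \<Rightarrow> real mat \<Rightarrow> bool" where
  "psd_mat m A \<longleftrightarrow>
     A \<in> carrier_mat m m \<and> transpose_mat A = A \<and>
     (\<forall>v\<in>carrier_vec m. scalar_prod v (A *\<^sub>v v) \<ge> 0)"

definition E0_mat :: "nat \<Rightarrow> real mat" where
  "E0_mat m = mat m m (\<lambda>(i, j). if i = 0 \<and> j = 0 then 1 else 0)"

definition symmetric3 :: "(real \<times> real \<times> real \<Rightarrow> real) \<Rightarrow> bool" where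
  "symmetric3 F \<longleftrightarrow> (\<forall>x y z.
     F (x, z, y) = F (x, y, z) \<and> F (y, x, z) = F (x, y, z) \<and> F (y, z, x) = F (x, y, z) \<and>
     F (z, x, y) = F (x, y, z) \<and> F (z, y, x) = F (x, y, z))"

definition BV :: "nat \<Rightarrow> real \<Rightarrow> (real \<times> real \<times> real \<Rightarrow> real) set" where
  "BV n f0 = {F. real_polynomial_function F \<and> symmetric3 F \<and>
     (\<exists>d M. (\<forall>k\<le>d. psd_mat (d - k + 1) (M k)) \<and>
            psd_mat (d + 1) (M 0 - f0 \<cdot>\<^sub>m E0_mat (d + 1)) \<and>
            (\<forall>p. F p = (\<Sum>k\<le>d. mat_inner (M k) (S_mat n d k p))))}"

definition ext0 :: "real set \<Rightarrow> (real \<Rightarrow> real) \<Rightarrow> real \<Rightarrow> real" where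
  "ext0 T g x = (if x \<in> T then g x else 0)"

definition D_dom :: "real \<Rightarrow> (real \<times> real \<times> real) set" where
  "D_dom \<theta> = {(x, y, z). x \<in> {-1..cos \<theta>} \<and> y \<in> {-1..cos \<theta>} \<and> z \<in> {-1..cos \<theta>} \<and>
     1 + 2 * x * y * z - x\<^sup>2 - y\<^sup>2 - z\<^sup>2 \<ge> 0}"

(* Only the values of g on T enter. *)
definition F_class ::
  "nat \<Rightarrow> real \<Rightarrow> real set \<Rightarrow> (real \<Rightarrow> real) \<Rightarrow> real \<Rightarrow> real \<Rightarrow> (real \<times> real \<times> real \<Rightarrow> real) set" where
  "F_class n f0 T g B \<theta> = {F. F \<in> BV n f0 \<and>
     (\<forall>x\<in>{-1..cos \<theta>}. F (x, x, 1) \<le> B + 2 * ext0 T g x) \<and>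
     (\<forall>(x, y, z)\<in>D_dom \<theta>. F (x, y, z) \<le> ext0 T g x + ext0 T g y + ext0 T g z)}"

end

theory Submission
  imports Defs
begin

text \<open>Sum $F$ over all triples of code points, at $(u\cdot w, v\cdot w, u\cdot v)$. The values of $F$ are
  bounded above by conditions (2) and (3), which leaves $3N\sum_{u,v} g_T(u\cdot v)$ plus diagonal terms; the number of
  ordered pairs with inner product in $T$ is even, whence the ceiling. From below the sum is at least
  $f_0 N^3$, because for each fixed $w$ the matrices $\sum_{u,v} Y_k^n(u\cdot w, v\cdot w, u\cdot v)$ are positive
  semidefinite. This is Schoenberg's theorem in the hyperplane orthogonal to $w$, of dimension $m = n - 1$.
  It is proved by induction on the degree: raising the zonal kernel of degree $l$ by harmonic
  projection of $u_b \varphi(u)$, in both arguments, gives a positive multiple of that of degree $l + 1$, and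
  a finite sum of products $\varphi(u)\varphi(v)$ again. The Gegenbauer polynomials are obtained from
  $P_{l+1} = t P_l - (1-t^2) P_l' / (l+m-2)$.\<close>

hide_const (open) Module.smult Matrix.orthogonal

subsection \<open>Gegenbauer polynomials by their differential recurrence\<close>

text \<open>The definite descriptions behind \<open>gegenbauer\<close> and \<open>Y_entry\<close>
  yield nothing until existence and uniqueness are proved, so one explicit polynomial must supply
  degree, parity, orthogonality and the value 1 at 1. The recurrence for \<open>geg\<close> suits
  this because a step involves only P_l and P_l': the differential equation follows by induction,
  and in turn gives orthogonality and a recursion for the coefficients. The case n = 3 shapes the
  details: then m = 2, the weight is unbounded at the endpoints, and l + m - 2 vanishes at l = 0.
  That division by zero is harmless, since it multiplies the derivative of the constant 1, but two
  inductions treat l = 0 apart. Raising differentiates the kernel, so nonnegativity of quadratic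
  forms on finite point sets is too little to induct on; the induction carries an explicit finite
  sum of products of polynomials instead. Spaces of harmonics, integration over spheres and the
  addition theorem are thereby bypassed. The points u = w and u = -w project to 0 in the hyperplane
  and cannot be normalised there, which is why the kernels are kept in homogeneous polynomial
  form.\<close>

fun geg :: "nat \<Rightarrow> nat \<Rightarrow> real poly" where
  "geg m 0 = 1"
| "geg m (Suc l) = [:0, 1:] * geg m l - smult (1 / (real l + real m - 2)) ([:1, 0, -1:] * pderiv (geg m l))"

declare geg.simps(2) [simp del]

lemma geg_at_1 [simp]: "poly (geg m l) 1 = 1"
  by (induction l) (simp_all add: geg.simps)

lemma geg_1: "geg m (Suc 0) = [:0, 1:]"
  by (simp add: geg.simps)

lemma pderiv_geg_Suc_aux:
  fixes t P P1 P2 m l :: real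
  assumes ode: "(1 - t\<^sup>2) * P2 - (m - 1) * t * P1 + l * (l + m - 2) * P = 0"
    and D: "l + m - 2 \<noteq> 0"
  shows "P + t * P1 - ((1 - t\<^sup>2) * P2 - 2 * t * P1) / (l + m - 2) = (l + 1) * (P + t * P1 / (l + m - 2))"
proof -
  have e: "(1 - t\<^sup>2) * P2 = (m - 1) * t * P1 - l * (l + m - 2) * P" using ode by simp
  show ?thesis unfolding e using D by (simp add: field_simps)
qed

text \<open>Differentiating the recurrence and removing P_l'' by the equation in degree l gives
  P_{l+1}' = (l+1) (P_l + t P_l' / (l+m-2)). With this formula and the recurrence, the equation in
  degree l + 1 reduces to the one in degree l.\<close>

lemma geg_ode:
  assumes "m \<ge> 2"
  shows "[:1, 0, -1:] * pderiv (pderiv (geg m l)) - smult (real m - 1) ([:0, 1:] * pderiv (geg m l))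
     + smult (real l * (real l + real m - 2)) (geg m l) = 0"
    (is "?ode l")
proof -
  have step: "pderiv (geg m (Suc l)) =
     smult (real l + 1) (geg m l + smult (1 / (real l + real m - 2)) ([:0, 1:] * pderiv (geg m l)))"
    if "?ode l" "l > 0" for l
  proof (rule poly_eq_poly_eq_iff[THEN iffD1], rule ext)
    fix t
    have "(1 - t\<^sup>2) * poly (pderiv (pderiv (geg m l))) t - (real m - 1) * t * poly (pderiv (geg m l)) t
       + real l * (real l + real m - 2) * poly (geg m l) t = 0"
      using arg_cong[OF that(1), of "\<lambda>p. poly p t"] by (simp add: algebra_simps power2_eq_square)
    from pderiv_geg_Suc_aux[OF this] assms that(2)
    have "poly (geg m l) t + t * poly (pderiv (geg m l)) t
        - ((1 - t\<^sup>2) * poly (pderiv (pderiv (geg m l))) t - 2 * t * poly (pderiv (geg m l)) t) / (real l + real m - 2) =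
        (real l + 1) * (poly (geg m l) t + t * poly (pderiv (geg m l)) t / (real l + real m - 2))"
      by simp
    moreover have "poly (pderiv (geg m (Suc l))) t = poly (geg m l) t + t * poly (pderiv (geg m l)) t
        - ((1 - t\<^sup>2) * poly (pderiv (pderiv (geg m l))) t - 2 * t * poly (pderiv (geg m l)) t) / (real l + real m - 2)"
      by (simp add: geg.simps pderiv_diff pderiv_smult pderiv_mult pderiv_pCons del: mult_pCons_left)
         (simp add: algebra_simps power2_eq_square add_divide_distrib diff_divide_distrib)
    ultimately show "poly (pderiv (geg m (Suc l))) t = poly (smult (real l + 1)
        (geg m l + smult (1 / (real l + real m - 2)) ([:0, 1:] * pderiv (geg m l)))) t"
      by simp
  qed
  show "?ode l"
  proof (induction l)
    case 0
    then show ?case by simp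
  next
    case (Suc l)
    show ?case
    \<comment> \<open>If m = 2 and l = 0, the denominator l + m - 2 is 0 and \<open>step\<close>
      does not apply; P_1 = t is checked directly.\<close>
    proof (cases "l = 0")
      case True
      then show ?thesis by (simp add: geg_1 pderiv_pCons)
    next
      case False
      define D where "D = real l + real m - 2"
      have D: "D \<noteq> 0" "real m = D - real l + 2" using False assms by (auto simp: D_def)
      show ?thesis
      proof (rule poly_eq_poly_eq_iff[THEN iffD1], rule ext)
        fix t
        define P where "P = poly (geg m l) t"
        define P1 where "P1 = poly (pderiv (geg m l)) t"
        define P2 where "P2 = poly (pderiv (pderiv (geg m l))) t"
        have e: "(1 - t\<^sup>2) * P2 = (real m - 1) * t * P1 - real l * D * P"
          using arg_cong[OF Suc.IH, of "\<lambda>p. poly p t"]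
          by (simp add: algebra_simps power2_eq_square P_def P1_def P2_def D_def)
        have 1: "poly (pderiv (geg m (Suc l))) t = (real l + 1) * (P + t * P1 / D)"
          using False by (simp add: step[OF Suc.IH] P_def P1_def D_def)
        have 2: "poly (pderiv (pderiv (geg m (Suc l)))) t = (real l + 1) * (P1 + (P1 + t * P2) / D)"
          using False
          by (simp add: step[OF Suc.IH] P_def P1_def P2_def D_def pderiv_smult pderiv_add pderiv_mult pderiv_pCons del: mult_pCons_left)
        have 0: "poly (geg m (Suc l)) t = t * P - (1 - t\<^sup>2) * P1 / D"
          by (simp add: geg.simps P_def P1_def D_def del: mult_pCons_left)(simp add: algebra_simps power2_eq_square)
        have "(1 - t\<^sup>2) * (P1 + (P1 + t * P2) / D) =
            (1 - t\<^sup>2) * P1 + ((1 - t\<^sup>2) * P1 + t * ((1 - t\<^sup>2) * P2)) / D"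
          by (simp add: algebra_simps add_divide_distrib diff_divide_distrib)
        also have "\<dots> = (1 - t\<^sup>2) * P1 + ((1 - t\<^sup>2) * P1 + t * ((real m - 1) * t * P1 - real l * D * P)) / D"
          unfolding e ..
        finally have 3: "(1 - t\<^sup>2) * (P1 + (P1 + t * P2) / D) = \<dots>" .
        have "(1 - t\<^sup>2) * ((real l + 1) * (P1 + (P1 + t * P2) / D))
          - (real m - 1) * t * ((real l + 1) * (P + t * P1 / D))
          + (real l + 1) * (D + 1) * (t * P - (1 - t\<^sup>2) * P1 / D) =
          (real l + 1) * ((1 - t\<^sup>2) * (P1 + (P1 + t * P2) / D) - (real m - 1) * t * (P + t * P1 / D)
            + (D + 1) * (t * P - (1 - t\<^sup>2) * P1 / D))"
          by (simp add: algebra_simps add_divide_distrib diff_divide_distrib)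
        also have "\<dots> = 0"
          unfolding 3 using D(1) by (simp add: D(2) field_simps power2_eq_square; simp add: algebra_simps)
        finally show "poly ([:1, 0, -1:] * pderiv (pderiv (geg m (Suc l)))
             - smult (real m - 1) ([:0, 1:] * pderiv (geg m (Suc l)))
             + smult (real (Suc l) * (real (Suc l) + real m - 2)) (geg m (Suc l))) t = poly 0 t"
          by (simp add: 0 1 2 D(2) power2_eq_square del: mult_pCons_left) (simp add: algebra_simps)
      qed
    qed
  qed
qed

lemma coeff_geg_Suc:
  "coeff (geg m (Suc l)) i =
    (if i = 0 then 0 else (1 + (real i - 1) / (real l + real m - 2)) * coeff (geg m l) (i - 1))
    - (real i + 1) / (real l + real m - 2) * coeff (geg m l) (Suc i)"
proof -
  have "[:1, 0, -1:] * pderiv (geg m l) = pderiv (geg m l) - pCons 0 (pCons 0 (pderiv (geg m l)))"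
    by simp
  then show ?thesis
    by (simp add: geg.simps coeff_pCons coeff_pderiv algebra_simps add_divide_distrib split: nat.splits)
       (simp add: diff_divide_distrib)
qed

text \<open>The coefficient of t^i in \<open>geg_ode\<close>. It drives the cancellation in
  \<open>geg_hom_Suc\<close>.\<close>

lemma coeff_geg_rec:
  assumes "m \<ge> 2"
  shows "(real i + 2) * (real i + 1) * coeff (geg m l) (i + 2) =
    (real i - real l) * (real i + real l + real m - 2) * coeff (geg m l) i"
proof -
  have "[:1, 0, -1:] * pderiv (pderiv (geg m l)) = pderiv (pderiv (geg m l)) - pCons 0 (pCons 0 (pderiv (pderiv (geg m l))))"
    by simp
  then show ?thesis
    using arg_cong[OF geg_ode[OF assms, of l], of "\<lambda>p. coeff p i"]
    by (cases i; cases "i - 1") (simp_all add: coeff_pCons coeff_pderiv algebra_simps)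
qed

lemma coeff_geg_parity: "odd (l + i) \<Longrightarrow> coeff (geg m l) i = 0"
proof (induction l arbitrary: i)
  case 0
  then show ?case by (cases i) (auto simp: coeff_pCons)
next
  case (Suc l)
  then show ?case by (cases i) (auto simp: coeff_geg_Suc)
qed

lemma degree_geg:
  assumes "m \<ge> 2"
  shows "degree (geg m l) = l \<and> coeff (geg m l) l > 0"
proof (induction l)
  case 0
  then show ?case by simp
next
  case (Suc l)
  have "coeff (geg m (Suc l)) i = 0" if "i > Suc l" for i
    using that Suc by (simp add: coeff_geg_Suc coeff_eq_0)
  then have 1: "degree (geg m (Suc l)) \<le> Suc l"
    by (simp add: degree_le)
  have "1 + (real l) / (real l + real m - 2) > 0"
    using assms by (intro add_pos_nonneg divide_nonneg_nonneg) auto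
  then have 2: "coeff (geg m (Suc l)) (Suc l) > 0"
    using Suc by (simp add: coeff_geg_Suc coeff_eq_0)
  with 1 show ?case
    by (metis le_antisym le_degree less_irrefl)
qed

subsection \<open>Orthogonality and uniqueness\<close>

abbreviation geg_weight :: "nat \<Rightarrow> real \<Rightarrow> real" where
  "geg_weight m t \<equiv> (1 - t\<^sup>2) powr ((real m - 3) / 2)"

lemma one_minus_square_pos: "-1 < t \<Longrightarrow> t < 1 \<Longrightarrow> 0 < 1 - t\<^sup>2" for t :: real
  by (simp add: abs_square_less_1)

text \<open>This is the weight for m = 2, the most singular case, which dominates all the others on
  the open interval. It is integrable because its antiderivative \<open>arcsin\<close> is continuous
  up to the endpoints.\<close>

lemma arcsin_deriv_integrable: "set_integrable lborel {-1<..<1} (\<lambda>t::real. inverse (sqrt (1 - t\<^sup>2)))"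
proof -
  have "set_integrable lborel (einterval (ereal (-1)) (ereal 1)) (\<lambda>t::real. inverse (sqrt (1 - t\<^sup>2)))"
  proof (rule interval_integral_FTC_nonneg(1)[where F = arcsin and A = "arcsin (-1)" and B = "arcsin 1"])
    fix x assume "ereal (-1) < ereal x" "ereal x < ereal 1"
    then have x: "-1 < x" "x < 1" by auto
    then show "DERIV arcsin x :> inverse (sqrt (1 - x\<^sup>2))" by (rule DERIV_arcsin)
    show "isCont (\<lambda>t. inverse (sqrt (1 - t\<^sup>2))) x"
      using one_minus_square_pos[OF x] by (intro continuous_intros) auto
  next
    show "AE x in lborel. ereal (-1) < ereal x \<longrightarrow> ereal x < ereal 1 \<longrightarrow> 0 \<le> inverse (sqrt (1 - x\<^sup>2))"
      using one_minus_square_pos by (intro AE_I2) (auto simp: less_imp_le)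
    have c: "continuous_on {-1..1} arcsin" by (rule continuous_on_arcsin')
    have "(arcsin \<longlongrightarrow> arcsin (-1)) (at (-1) within {-1..1})" "(arcsin \<longlongrightarrow> arcsin 1) (at 1 within {-1..1})"
      using c by (simp_all add: continuous_on_def del: arcsin_1 arcsin_minus_1)
    then show "((arcsin \<circ> real_of_ereal) \<longlongrightarrow> arcsin (-1)) (at_right (ereal (-1)))"
      "((arcsin \<circ> real_of_ereal) \<longlongrightarrow> arcsin 1) (at_left (ereal 1))"
      unfolding ereal_tendsto_simps by (simp_all add: at_within_Icc_at_right at_within_Icc_at_left)
  qed simp
  then show ?thesis by simp
qed

text \<open>By \<open>0 powr a = 0\<close> the weight vanishes at the endpoints even when its
  exponent is negative, so the closed and the open interval can be exchanged pointwise.\<close>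

lemma geg_weight_indicator:
  "indicator {-1..1} t *\<^sub>R (c * geg_weight m t) = indicator {-1<..<1} t *\<^sub>R (c * geg_weight m t)"
proof -
  have "geg_weight m t = 0" if "t \<in> {-1..1}" "t \<notin> {-1<..<1}"
  proof -
    have "t = 1 \<or> t = -1" using that by auto
    then show ?thesis by auto
  qed
  then show ?thesis by (auto simp: indicator_def)
qed

lemma geg_weight_integrable_open:
  assumes "m \<ge> 2"
  shows "set_integrable lborel {-1<..<1} (\<lambda>t. poly p t * geg_weight m t)"
proof -
  have "compact ((\<lambda>t. poly p t) ` {-1..1})"
    by (intro compact_continuous_image continuous_intros) auto
  then obtain K where K: "\<And>t. t \<in> {-1..1} \<Longrightarrow> \<bar>poly p t\<bar> \<le> K"
    by (metis bounded_iff compact_imp_bounded imageI real_norm_def)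
  show ?thesis
  proof (rule set_integrable_bound)
    show "set_integrable lborel {-1<..<1} (\<lambda>t::real. K * inverse (sqrt (1 - t\<^sup>2)))"
      by (rule set_integrable_mult_right[OF arcsin_deriv_integrable])
    have [measurable]: "poly p \<in> borel_measurable borel"
      by (intro borel_measurable_continuous_onI continuous_intros)
    have [measurable]: "geg_weight m \<in> borel_measurable borel"
      by measurable
    show "set_borel_measurable lborel {-1<..<1} (\<lambda>t. poly p t * geg_weight m t)"
      unfolding set_borel_measurable_def by measurable
    show "AE t in lborel. t \<in> {-1<..<1} \<longrightarrow>
       norm (poly p t * geg_weight m t) \<le> norm (K * inverse (sqrt (1 - t\<^sup>2)))"
    proof (intro AE_I2 impI)
      fix t :: real assume t: "t \<in> {-1<..<1}"
      then have pos: "0 < 1 - t\<^sup>2" using one_minus_square_pos by auto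
      have "geg_weight m t \<le> (1 - t\<^sup>2) powr (- (1/2))"
        using pos assms by (intro powr_mono') auto
      also have "\<dots> = inverse (sqrt (1 - t\<^sup>2))"
        using pos by (simp add: powr_minus powr_half_sqrt)
      finally have w: "geg_weight m t \<le> inverse (sqrt (1 - t\<^sup>2))" .
      have "norm (poly p t * geg_weight m t) = \<bar>poly p t\<bar> * geg_weight m t"
        by (simp add: abs_mult)
      also have "\<dots> \<le> K * inverse (sqrt (1 - t\<^sup>2))"
        using w K[of t] t by (intro mult_mono) auto
      finally show "norm (poly p t * geg_weight m t) \<le> norm (K * inverse (sqrt (1 - t\<^sup>2)))"
        by (rule order_trans) simp
    qed
  qed
qed

lemma geg_weight_integrable:
  assumes "m \<ge> 2"
  shows "set_integrable lborel {-1..1} (\<lambda>t. poly p t * geg_weight m t)"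
  using geg_weight_integrable_open[OF assms, of p]
  unfolding set_integrable_def geg_weight_indicator .

definition geg_int :: "nat \<Rightarrow> real poly \<Rightarrow> real" where
  "geg_int m p = (LINT t:{-1..1}|lborel. poly p t * geg_weight m t)"

lemma geg_int_add:
  assumes "m \<ge> 2"
  shows "geg_int m (p + q) = geg_int m p + geg_int m q"
  unfolding geg_int_def
  by (subst set_integral_add(2)[OF geg_weight_integrable[OF assms] geg_weight_integrable[OF assms], symmetric])
     (simp add: algebra_simps)

lemma geg_int_smult: "geg_int m (smult c p) = c * geg_int m p"
  unfolding geg_int_def by (simp add: mult.assoc)

text \<open>A zero integral would make the nonnegative integrand vanish almost everywhere. Inside
  the open interval it is positive off the finitely many roots of p, so the interval would be a null
  set.\<close>

lemma geg_int_pos: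
  assumes "m \<ge> 2" "p \<noteq> 0"
  shows "geg_int m (p * p) > 0"
proof -
  define f where "f t = indicator {-1..1} t *\<^sub>R (poly (p * p) t * geg_weight m t)" for t
  have f: "integrable lborel f"
    using geg_weight_integrable[OF assms(1), of "p * p"] unfolding set_integrable_def f_def .
  have nn: "f t \<ge> 0" for t by (simp add: f_def)
  have "geg_int m (p * p) = integral\<^sup>L lborel f"
    unfolding geg_int_def set_lebesgue_integral_def f_def ..
  moreover have "integral\<^sup>L lborel f \<noteq> 0"
  proof
    assume "integral\<^sup>L lborel f = 0"
    then have "AE t in lborel. f t = 0"
      using integral_nonneg_eq_0_iff_AE[OF f] nn by auto
    moreover have "AE t in lborel. t \<notin> {t. poly p t = 0}"
      by (rule AE_not_in) (auto intro!: finite_imp_null_set_lborel poly_roots_finite assms)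
    ultimately have "AE t in lborel. t \<notin> {-1<..<1::real}"
    proof eventually_elim
      case (elim t)
      show ?case
      proof
        assume t: "t \<in> {-1<..<1}"
        then have "0 < 1 - t\<^sup>2" using one_minus_square_pos by auto
        with elim t show False by (auto simp: f_def)
      qed
    qed
    then have "{-1<..<1::real} \<in> null_sets lborel"
      by (subst AE_iff_null_sets) auto
    then have "emeasure lborel {-1<..<1::real} = 0" by (auto dest: null_setsD1)
    then show False by simp
  qed
  moreover have "integral\<^sup>L lborel f \<ge> 0" using nn by simp
  ultimately show ?thesis by linarith
qed

text \<open>The differential equation in Sturm--Liouville form: the total derivative below is
  $(\lambda_j - \lambda_k) P_j P_k w$, where $\lambda_l = l (l + m - 2)$ and $w$ is the weight.\<close>

lemma geg_orthogonal:
  assumes "m \<ge> 2" "j \<noteq> k"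
  shows "geg_int m (geg m j * geg m k) = 0"
proof -
  define c where "c = real j * (real j + real m - 2) - real k * (real k + real m - 2)"
  \<comment> \<open>Both factors are nonzero: j \<noteq> k forces j + k > 0, and m \<ge> 2.\<close>
  have "c = (real j - real k) * (real j + real k + real m - 2)"
    by (simp add: c_def algebra_simps)
  with assms have "c \<noteq> 0" by auto
  define q where "q = geg m j * pderiv (geg m k) - pderiv (geg m j) * geg m k"
  \<comment> \<open>One more than the exponent of the weight. It is positive also for m = 2, so
    \<open>F\<close> tends to 0 at the endpoints although the weight itself may blow up
    there.\<close>
  define e where "e = (real m - 1) / 2"
  have e: "e > 0" using assms by (simp add: e_def)
  define F where "F t = (1 - t\<^sup>2) powr e * poly q t" for t
  define f where "f t = c * (poly (geg m j * geg m k) t * geg_weight m t)" for t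
  have lim: "(F \<longlongrightarrow> F x) (at x within S)" if S: "S \<subseteq> {-1..1}" "S \<noteq> {}" for x S
    unfolding F_def
  proof (rule tendsto_mult)
    have "((\<lambda>t. 1 - t\<^sup>2) \<longlongrightarrow> 1 - x\<^sup>2) (at x within S)" by (intro tendsto_intros)
    moreover have "1 - x\<^sup>2 \<noteq> 0 \<or> 0 < e \<and> (\<forall>\<^sub>F y in at x within S. 0 \<le> 1 - y\<^sup>2)"
      using e S by (auto simp: eventually_at_filter abs_square_le_1 subset_iff intro!: always_eventually)
    ultimately show "((\<lambda>t. (1 - t\<^sup>2) powr e) \<longlongrightarrow> (1 - x\<^sup>2) powr e) (at x within S)"
      by (intro tendsto_powr' tendsto_const)
    show "((\<lambda>t. poly q t) \<longlongrightarrow> poly q x) (at x within S)"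
      by (rule tendsto_poly) (rule tendsto_ident_at)
  qed
  have "(LBINT x=ereal (-1)..ereal 1. f x) = 0 - 0"
  proof (rule interval_integral_FTC_integrable[where F = F])
    show "set_integrable lborel (einterval (ereal (-1)) (ereal 1)) f"
      unfolding f_def
      using set_integrable_mult_right[OF geg_weight_integrable_open[OF assms(1), of "geg m j * geg m k"], of c]
      by simp
    have "(F \<longlongrightarrow> F (-1)) (at_right (-1))" "(F \<longlongrightarrow> F 1) (at_left 1)"
      using lim[of "{-1..1}" "-1"] lim[of "{-1..1}" 1] by (simp_all add: at_within_Icc_at_right at_within_Icc_at_left)
    then show "((F \<circ> real_of_ereal) \<longlongrightarrow> 0) (at_right (ereal (-1)))"
      "((F \<circ> real_of_ereal) \<longlongrightarrow> 0) (at_left (ereal 1))"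
      unfolding ereal_tendsto_simps by (simp_all add: F_def)
  next
    fix x assume "ereal (-1) < ereal x" "ereal x < ereal 1"
    then have pos: "0 < 1 - x\<^sup>2" using one_minus_square_pos by auto
    show "isCont f x"
      unfolding f_def using pos by (intro continuous_intros) auto
    have w: "geg_weight m x = (1 - x\<^sup>2) powr (e - 1)"
      by (simp add: e_def field_simps)
    have w': "(1 - x\<^sup>2) powr e = (1 - x\<^sup>2) * geg_weight m x"
      using pos unfolding w by (subst powr_diff) simp
    define W where "W = geg_weight m x"
    have m2: "real m = 2 * e + 1" by (simp add: e_def field_simps)
    have ode: "(1 - x\<^sup>2) * poly (pderiv (pderiv (geg m l))) x = 2 * e * x * poly (pderiv (geg m l)) x
       - real l * (real l + real m - 2) * poly (geg m l) x" for l
      using arg_cong[OF geg_ode[OF assms(1), of l], of "\<lambda>p. poly p x"]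
      by (simp add: algebra_simps power2_eq_square m2)
    have "(F has_real_derivative
       (e * (1 - x\<^sup>2) powr (e - 1) * (- 2 * x) * poly q x + (1 - x\<^sup>2) powr e * poly (pderiv q) x)) (at x)"
      unfolding F_def using pos by (auto intro!: derivative_eq_intros simp: powr_diff field_simps)
    also have "(e * (1 - x\<^sup>2) powr (e - 1) * (- 2 * x) * poly q x + (1 - x\<^sup>2) powr e * poly (pderiv q) x)
       = W * (- 2 * e * x * poly q x + (1 - x\<^sup>2) * poly (pderiv q) x)"
      unfolding w' w[symmetric] W_def[symmetric] by (simp add: algebra_simps)
    also have "(1 - x\<^sup>2) * poly (pderiv q) x =
      poly (geg m j) x * ((1 - x\<^sup>2) * poly (pderiv (pderiv (geg m k))) x)
      - ((1 - x\<^sup>2) * poly (pderiv (pderiv (geg m j))) x) * poly (geg m k) x"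
      by (simp add: q_def pderiv_diff pderiv_mult algebra_simps)
    also have "W * (- 2 * e * x * poly q x + \<dots>) = f x"
      unfolding ode by (simp add: f_def q_def W_def c_def algebra_simps)
    finally show "(F has_vector_derivative f x) (at x)"
      by (simp add: has_real_derivative_iff_has_vector_derivative)
  qed simp
  then have "0 = (LINT t:{-1<..<1}|lborel. f t)"
    by (simp add: interval_lebesgue_integral_def)
  also have "\<dots> = c * geg_int m (geg m j * geg m k)"
    unfolding geg_int_def f_def set_integral_mult_right
    by (simp only: set_lebesgue_integral_def geg_weight_indicator)
  finally show ?thesis using \<open>c \<noteq> 0\<close> by simp
qed

text \<open>Induction on the degree of r: subtracting the multiple of the P of the same degree that
  cancels the leading coefficient leaves a polynomial that is 0 or of lower degree.\<close>

lemma geg_int_orthogonal_lower_degree: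
  assumes "m \<ge> 2" and P: "\<And>j. degree (P j) = j" "\<And>j. P j \<noteq> 0"
    and orth: "\<And>j. j < k \<Longrightarrow> geg_int m (P j * q) = 0"
    and r: "degree r < k"
  shows "geg_int m (r * q) = 0"
  using r
proof (induction "degree r" arbitrary: r rule: less_induct)
  case less
  let ?d = "degree r"
  have z: "geg_int m 0 = 0" using geg_int_smult[of m 0 0] by simp
  define c where "c = lead_coeff r / lead_coeff (P ?d)"
  define s where "s = r - smult c (P ?d)"
  have "coeff s ?d = 0"
    using P(2)[of ?d] P(1)[of ?d] leading_coeff_0_iff[of "P ?d"] by (simp add: s_def c_def)
  moreover have "degree s \<le> ?d"
    unfolding s_def using P(1)[of ?d] degree_smult_le[of c "P ?d"] by (intro degree_diff_le) auto
  ultimately have "s = 0 \<or> degree s < ?d"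
    by (metis le_neq_implies_less leading_coeff_0_iff)
  then have "geg_int m (s * q) = 0" using less z by auto
  moreover have "geg_int m (P ?d * q) = 0" using orth less.prems by simp
  moreover have "r * q = s * q + smult c (P ?d * q)"
    by (simp add: s_def algebra_simps)
  ultimately show ?case by (simp add: geg_int_add[OF assms(1)] geg_int_smult)
qed

text \<open>Strong induction on k. Removing from \<open>P k\<close> the multiple of
  \<open>geg m k\<close> with the same leading coefficient leaves r of degree below k. It is
  orthogonal to every lower \<open>P j\<close>, since that is \<open>geg m j\<close> by induction;
  so r is orthogonal to itself, hence 0. The value at 1 fixes the factor.\<close>

lemma geg_unique:
  assumes "m \<ge> 2" and P: "\<And>k. degree (P k) = k" "\<And>k. poly (P k) 1 = 1"
    and orth: "\<And>j k. j \<noteq> k \<Longrightarrow> geg_int m (P j * P k) = 0"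
  shows "P k = geg m k"
proof (induction k rule: less_induct)
  case (less k)
  have geg0: "geg m k \<noteq> 0" using geg_at_1[of m k] by (metis poly_0 zero_neq_one)
  have P0: "P j \<noteq> 0" for j using P(2)[of j] by (metis poly_0 zero_neq_one)
  define c where "c = lead_coeff (P k) / lead_coeff (geg m k)"
  define r where "r = P k - smult c (geg m k)"
  have "coeff r k = 0"
    using P(1)[of k] degree_geg[OF assms(1), of k] by (simp add: r_def c_def)
  moreover have "degree r \<le> k"
    unfolding r_def using P(1)[of k] degree_geg[OF assms(1), of k] degree_smult_le[of c "geg m k"]
    by (intro degree_diff_le) auto
  ultimately have r: "r = 0 \<or> degree r < k"
    by (metis le_neq_implies_less leading_coeff_0_iff)
  have "r = 0"
  proof (rule ccontr)
    assume nz: "r \<noteq> 0"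
    have "geg_int m (P j * r) = 0" if "j < k" for j
    proof -
      have "P j * r = P j * P k + smult (- c) (geg m j * geg m k)"
        using less.IH[OF that] by (simp add: r_def algebra_simps)
      then show ?thesis
        using that orth[of j k] geg_orthogonal[OF assms(1), of j k]
        by (simp add: geg_int_add[OF assms(1)] geg_int_smult del: smult_minus_left)
    qed
    from geg_int_orthogonal_lower_degree[OF assms(1) P(1) P0 this] nz r
    have "geg_int m (r * r) = 0" by blast
    with geg_int_pos[OF assms(1) nz] show False by simp
  qed
  then have Pk: "P k = smult c (geg m k)" by (simp add: r_def)
  then have "c = 1" using P(2)[of k] by simp
  with Pk show ?case by simp
qed

lemma gegenbauer_eq_geg:
  assumes "m \<ge> 2"
  shows "gegenbauer m = geg m"
  unfolding gegenbauer_def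
proof (rule the_equality)
  have *: "(LINT t:{-1..1}|lborel. poly p t * poly q t * geg_weight m t) = geg_int m (p * q)" for p q
    by (simp add: geg_int_def)
  show "(\<forall>k. degree (geg m k) = k \<and> poly (geg m k) 1 = 1) \<and>
     (\<forall>j k. j \<noteq> k \<longrightarrow> (LINT t:{-1..1}|lborel. poly (geg m j) t * poly (geg m k) t * geg_weight m t) = 0)"
    unfolding * using degree_geg geg_orthogonal assms by simp
  fix P :: "nat \<Rightarrow> real poly"
  assume "(\<forall>k. degree (P k) = k \<and> poly (P k) 1 = 1) \<and>
     (\<forall>j k. j \<noteq> k \<longrightarrow> (LINT t:{-1..1}|lborel. poly (P j) t * poly (P k) t * geg_weight m t) = 0)"
  then show "P = geg m"
    unfolding * using geg_unique[OF assms, of P] by auto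
qed

subsection \<open>The entries of the matrices $Y_k^n$\<close>

text \<open>The homogenisation r^(k/2) P_k(t / sqrt r), written as a polynomial in t and r so that
  it makes sense for r = 0. By parity only indices with k - i even contribute, and for these the
  integer division by 2 is exact.\<close>

definition geg_hom :: "nat \<Rightarrow> nat \<Rightarrow> real \<Rightarrow> real \<Rightarrow> real" where
  "geg_hom m k t r = (\<Sum>i\<le>k. coeff (geg m k) i * t ^ i * r ^ ((k - i) div 2))"

lemma geg_hom_eq:
  assumes "m \<ge> 2" "r > 0"
  shows "r powr (real k / 2) * poly (geg m k) (t / sqrt r) = geg_hom m k t r"
proof -
  have r: "r powr (real k / 2) = sqrt r ^ k"
    using assms(2) by (simp add: powr_half_sqrt[symmetric] powr_powr flip: powr_realpow)
  have "sqrt r ^ k * (coeff (geg m k) i * (t / sqrt r) ^ i) =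
      coeff (geg m k) i * t ^ i * r ^ ((k - i) div 2)" if "i \<le> k" for i
  proof (cases "even (k + i)")
    case True
    then obtain j where "k - i = 2 * j" using that by (metis dvdE even_diff_nat even_add)
    with that have k: "k = i + 2 * j" by simp
    have "sqrt r ^ k = sqrt r ^ i * r ^ j"
      using assms(2) by (simp add: k power_add power_mult)
    then show ?thesis using assms(2) by (simp add: k power_divide)
  next
    case False
    then show ?thesis by (simp add: coeff_geg_parity)
  qed
  then show ?thesis
    using degree_geg[OF assms(1), of k]
    unfolding poly_altdef geg_hom_def r sum_distrib_left by (intro sum.cong) auto
qed

lemma real_polynomial_function_zero_near_0:
  fixes f :: "real \<Rightarrow> real"
  assumes f: "real_polynomial_function f" and "e > 0" and z: "\<And>s. \<bar>s\<bar> < e \<Longrightarrow> f s = 0"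
  shows "f s = 0"
proof -
  obtain a n where a: "f = (\<lambda>x. \<Sum>i\<le>n. a i * x ^ i)"
    using real_polynomial_function_imp_sum[OF f] by blast
  define p where "p = (\<Sum>i\<le>n. monom (a i) i)"
  have f: "f x = poly p x" for x by (simp add: a p_def poly_sum poly_monom)
  have "p = 0"
  proof (rule ccontr)
    assume "p \<noteq> 0"
    then have "finite {x. poly p x = 0}" by (rule poly_roots_finite)
    moreover have "{0<..<e} \<subseteq> {x. poly p x = 0}" using z by (auto simp flip: f)
    ultimately have "finite {0<..<e}" by (rule finite_subset[rotated])
    then show False using \<open>e > 0\<close> infinite_Ioo by blast
  qed
  then show ?thesis by (simp add: f)
qed

text \<open>Restricted to the line through 0 and p, the difference is a univariate polynomial that
  vanishes near 0, hence also at parameter 1.\<close>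

lemma real_polynomial_function_eq_near_0:
  fixes f g :: "'a::real_normed_vector \<Rightarrow> real"
  assumes f: "real_polynomial_function f" and g: "real_polynomial_function g"
    and "e > 0" and eq: "\<And>p. norm p < e \<Longrightarrow> f p = g p"
  shows "f = g"
proof
  fix p :: 'a
  have 1: "polynomial_function (\<lambda>s. s *\<^sub>R p)"
    by (intro polynomial_function_mult) (auto simp flip: real_polynomial_function_eq)
  have "real_polynomial_function ((\<lambda>q. f q - g q) \<circ> (\<lambda>s. s *\<^sub>R p))"
    by (rule real_polynomial_function_compose[OF 1 real_polynomial_function_diff[OF f g]])
  \<comment> \<open>The summand 1 keeps the denominator positive when p = 0.\<close>
  moreover have "f (s *\<^sub>R p) - g (s *\<^sub>R p) = 0" if "\<bar>s\<bar> < e / (norm p + 1)" for s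
  proof -
    have "norm (s *\<^sub>R p) \<le> \<bar>s\<bar> * (norm p + 1)" by (simp add: mult_left_mono)
    also have "\<dots> < e"
      using that by (simp add: pos_less_divide_eq add_nonneg_pos)
    finally show ?thesis using eq by simp
  qed
  moreover have "0 < e / (norm p + 1)"
    using \<open>e > 0\<close> by (simp add: add_nonneg_pos)
  ultimately have "((\<lambda>q. f q - g q) \<circ> (\<lambda>s. s *\<^sub>R p)) 1 = 0"
    by (rule_tac e = "e / (norm p + 1)" in real_polynomial_function_zero_near_0) (simp_all add: comp_def)
  then show "f p = g p" by simp
qed

text \<open>The right-hand side is a polynomial that agrees with the defining formula for |x|, |y| <
  1, and the values on the unit ball around 0 already determine it. The equation also holds for |x|
  = 1 or |y| = 1, values which occur as soon as two points of a triple coincide.\<close>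

lemma Y_entry_eq:
  assumes "n \<ge> 3"
  shows "Y_entry n k i j (x, y, z) = x ^ i * y ^ j * geg_hom (n - 1) k (z - x * y) ((1 - x\<^sup>2) * (1 - y\<^sup>2))"
proof -
  define Y where "Y = (\<lambda>(x::real, y::real, z::real).
      x ^ i * y ^ j * geg_hom (n - 1) k (z - x * y) ((1 - x\<^sup>2) * (1 - y\<^sup>2)))"
  have coord: "real_polynomial_function (\<lambda>p::real \<times> real \<times> real. fst p)"
    "real_polynomial_function (\<lambda>p::real \<times> real \<times> real. fst (snd p))"
    "real_polynomial_function (\<lambda>p::real \<times> real \<times> real. snd (snd p))"
    by (intro real_polynomial_function.intros(1) bounded_linear_fst bounded_linear_snd
        bounded_linear_compose[OF bounded_linear_fst] bounded_linear_compose[OF bounded_linear_snd])+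
  have Y: "real_polynomial_function Y"
    unfolding Y_def case_prod_beta geg_hom_def
    by (intro real_polynomial_function_sum real_polynomial_function_power real_polynomial_function_diff
        real_polynomial_function.intros(4) coord real_polynomial_function.intros(2)) auto
  have formula: "Y (x, y, z) = x ^ i * y ^ j * ((1 - x\<^sup>2) * (1 - y\<^sup>2)) powr (real k / 2) *
          poly (gegenbauer (n - 1) k) ((z - x * y) / sqrt ((1 - x\<^sup>2) * (1 - y\<^sup>2)))"
    if "\<bar>x\<bar> < 1" "\<bar>y\<bar> < 1" for x y z
  proof -
    have "(1 - x\<^sup>2) * (1 - y\<^sup>2) > 0"
      using that by (simp add: abs_square_less_1)
    from geg_hom_eq[OF _ this, of "n - 1" k "z - x * y"] show ?thesis
      using assms by (simp add: Y_def gegenbauer_eq_geg mult.assoc)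
  qed
  have "Y_entry n k i j = Y"
    unfolding Y_entry_def
  proof (rule the_equality)
    show "real_polynomial_function Y \<and> (\<forall>x y z. \<bar>x\<bar> < 1 \<and> \<bar>y\<bar> < 1 \<longrightarrow> Y (x, y, z) =
          x ^ i * y ^ j * ((1 - x\<^sup>2) * (1 - y\<^sup>2)) powr (real k / 2) *
          poly (gegenbauer (n - 1) k) ((z - x * y) / sqrt ((1 - x\<^sup>2) * (1 - y\<^sup>2))))"
      using Y formula by blast
    fix Z
    assume Z: "real_polynomial_function Z \<and> (\<forall>x y z. \<bar>x\<bar> < 1 \<and> \<bar>y\<bar> < 1 \<longrightarrow> Z (x, y, z) =
          x ^ i * y ^ j * ((1 - x\<^sup>2) * (1 - y\<^sup>2)) powr (real k / 2) *
          poly (gegenbauer (n - 1) k) ((z - x * y) / sqrt ((1 - x\<^sup>2) * (1 - y\<^sup>2))))"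
    show "Z = Y"
    proof (rule real_polynomial_function_eq_near_0[where e = 1])
      fix p :: "real \<times> real \<times> real"
      assume "norm p < 1"
      obtain x y z where p: "p = (x, y, z)" by (cases p)
      have "\<bar>x\<bar> \<le> norm p" "\<bar>y\<bar> \<le> norm p"
        using norm_fst_le[of x "(y, z)"] norm_fst_le[of y z] norm_snd_le[of "(y, z)" x] by (simp_all add: p)
      with \<open>norm p < 1\<close> show "Z p = Y p" unfolding p using Z formula by auto
    qed (use Z Y in auto)
  qed
  then show ?thesis by (simp add: Y_def)
qed

subsection \<open>Positive semidefinite polynomial kernels\<close>

inductive psd_kernel :: "('a::real_normed_vector \<Rightarrow> 'a \<Rightarrow> real) \<Rightarrow> bool" where
  zero: "psd_kernel (\<lambda>u v. 0)"
| rank1_add: "real_polynomial_function f \<Longrightarrow> psd_kernel K \<Longrightarrow> psd_kernel (\<lambda>u v. f u * f v + K u v)"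

lemma psd_kernel_rank1: "real_polynomial_function f \<Longrightarrow> psd_kernel (\<lambda>u v. f u * f v)"
  using psd_kernel.rank1_add[OF _ psd_kernel.zero] by simp

lemma psd_kernel_add: "psd_kernel K \<Longrightarrow> psd_kernel L \<Longrightarrow> psd_kernel (\<lambda>u v. K u v + L u v)"
  by (induction K rule: psd_kernel.induct) (auto simp: add.assoc intro: psd_kernel.rank1_add)

lemma psd_kernel_sum:
  "finite B \<Longrightarrow> (\<And>b. b \<in> B \<Longrightarrow> psd_kernel (K b)) \<Longrightarrow> psd_kernel (\<lambda>u v. \<Sum>b\<in>B. K b u v)"
  by (induction B rule: finite_induct) (auto intro: psd_kernel.zero psd_kernel_add)

lemma psd_kernel_scale:
  assumes "psd_kernel K" "c \<ge> 0"
  shows "psd_kernel (\<lambda>u v. c * K u v)"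
  using assms(1)
proof (induction K rule: psd_kernel.induct)
  case zero
  then show ?case by (simp add: psd_kernel.zero)
next
  case (rank1_add f K)
  have "real_polynomial_function (\<lambda>u. sqrt c * f u)"
    using rank1_add.hyps(1) by (intro real_polynomial_function.intros(2-))
  note psd_kernel.rank1_add[OF this rank1_add.IH]
  moreover have "sqrt c * (sqrt c * x) = c * x" for x
    using assms(2) by (simp flip: mult.assoc)
  ultimately show ?case by (simp add: algebra_simps)
qed

text \<open>For a single product f(u) f(v) the double sum is the quadratic form of M at the vector s
  with s_i = sum of p_i(u) f(u) over u in C. Adding up the products gives the claim.\<close>

lemma psd_kernel_quadratic_nonneg:
  assumes "psd_kernel K" "finite C"
    and M: "\<And>s :: nat \<Rightarrow> real. (\<Sum>i<d. \<Sum>j<d. M i j * s i * s j) \<ge> 0"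
  shows "(\<Sum>u\<in>C. \<Sum>v\<in>C. (\<Sum>i<d. \<Sum>j<d. M i j * (p i u * p j v)) * K u v) \<ge> 0"
  using assms(1)
proof (induction K rule: psd_kernel.induct)
  case zero
  then show ?case by simp
next
  case (rank1_add f K)
  have "(\<Sum>u\<in>C. \<Sum>v\<in>C. (\<Sum>i<d. \<Sum>j<d. M i j * (p i u * p j v)) * (f u * f v))
    = (\<Sum>u\<in>C. \<Sum>v\<in>C. \<Sum>i<d. \<Sum>j<d. M i j * (p i u * f u) * (p j v * f v))"
    by (simp add: sum_distrib_left sum_distrib_right mult_ac)
  also have "\<dots> = (\<Sum>u\<in>C. \<Sum>i<d. \<Sum>v\<in>C. \<Sum>j<d. M i j * (p i u * f u) * (p j v * f v))"
    by (intro sum.cong refl sum.swap)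
  also have "\<dots> = (\<Sum>i<d. \<Sum>u\<in>C. \<Sum>v\<in>C. \<Sum>j<d. M i j * (p i u * f u) * (p j v * f v))"
    by (rule sum.swap)
  also have "\<dots> = (\<Sum>i<d. \<Sum>u\<in>C. \<Sum>j<d. \<Sum>v\<in>C. M i j * (p i u * f u) * (p j v * f v))"
    by (intro sum.cong refl sum.swap)
  also have "\<dots> = (\<Sum>i<d. \<Sum>j<d. \<Sum>u\<in>C. \<Sum>v\<in>C. M i j * (p i u * f u) * (p j v * f v))"
    by (intro sum.cong refl sum.swap)
  also have "\<dots> = (\<Sum>i<d. \<Sum>j<d. M i j * (\<Sum>u\<in>C. p i u * f u) * (\<Sum>v\<in>C. p j v * f v))"
    by (simp add: sum_distrib_left sum_distrib_right mult_ac)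
  also have "\<dots> \<ge> 0" by (rule M)
  finally show ?case
    using rank1_add.IH by (simp add: distrib_left sum.distrib)
qed

section \<open>Raising a kernel by differentiation in both arguments\<close>

lemma real_polynomial_function_directional_derivative:
  assumes "real_polynomial_function f"
  shows "\<exists>f'. \<forall>b. real_polynomial_function (f' b) \<and>
    (\<forall>u. ((\<lambda>h. f (u + h *\<^sub>R b)) has_real_derivative f' b u) (at 0))"
  using assms
proof (induction f rule: real_polynomial_function.induct)
  case (linear f)
  have "((\<lambda>h. f (u + h *\<^sub>R b)) has_real_derivative f b) (at 0)" for u b
    unfolding linear_add[OF bounded_linear.linear[OF linear]] linear_scale[OF bounded_linear.linear[OF linear]]
    by (auto intro!: derivative_eq_intros)
  then show ?case by (intro exI[of _ "\<lambda>b u. f b"]) (auto intro: real_polynomial_function.intros)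
next
  case (const c)
  show ?case by (intro exI[of _ "\<lambda>b u. 0"]) (auto intro: real_polynomial_function.intros)
next
  case (add f g)
  then obtain f' g' where "\<And>b. real_polynomial_function (f' b)" "\<And>b. real_polynomial_function (g' b)"
    "\<And>b u. ((\<lambda>h. f (u + h *\<^sub>R b)) has_real_derivative f' b u) (at 0)"
    "\<And>b u. ((\<lambda>h. g (u + h *\<^sub>R b)) has_real_derivative g' b u) (at 0)"
    by metis
  then show ?case
    by (intro exI[of _ "\<lambda>b u. f' b u + g' b u"]) (auto intro: real_polynomial_function.intros DERIV_add)
next
  case (mult f g)
  then obtain f' g' where *: "\<And>b. real_polynomial_function (f' b)" "\<And>b. real_polynomial_function (g' b)"
    "\<And>b u. ((\<lambda>h. f (u + h *\<^sub>R b)) has_real_derivative f' b u) (at 0)"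
    "\<And>b u. ((\<lambda>h. g (u + h *\<^sub>R b)) has_real_derivative g' b u) (at 0)"
    by metis
  have "((\<lambda>h. f (u + h *\<^sub>R b) * g (u + h *\<^sub>R b)) has_real_derivative f' b u * g u + g' b u * f u) (at 0)" for b u
    using DERIV_mult[OF *(3)[of u b] *(4)[of u b]] by simp
  moreover have "real_polynomial_function (\<lambda>u. f' b u * g u + g' b u * f u)" for b
    using * mult.hyps by (intro real_polynomial_function.intros(3,4))
  ultimately show ?case
    by (intro exI[of _ "\<lambda>b u. f' b u * g u + g' b u * f u"]) simp
qed

text \<open>The operator u_b - c q(u) d/db, applied in both arguments and summed over b, turns f(u)
  f(v) into the sum of g_b(u) g_b(v), with g_b the function \<open>?g b\<close> of the proof. The
  derivatives are only asserted to exist, since the decomposition of K is unknown; concrete formulas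
  can be put in later by uniqueness of derivatives.\<close>

lemma psd_kernel_raise:
  fixes K :: "'a::real_inner \<Rightarrow> 'a \<Rightarrow> real"
  assumes "psd_kernel K" "finite B" "real_polynomial_function q"
  shows "\<exists>K1 K2 K12.
     (\<forall>b u v. ((\<lambda>h. K (u + h *\<^sub>R b) v) has_real_derivative K1 b u v) (at 0)) \<and>
     (\<forall>b u v. ((\<lambda>h. K u (v + h *\<^sub>R b)) has_real_derivative K2 b u v) (at 0)) \<and>
     (\<forall>b u v. ((\<lambda>h. K1 b u (v + h *\<^sub>R b)) has_real_derivative K12 b u v) (at 0)) \<and>
     psd_kernel (\<lambda>u v. \<Sum>b\<in>B. (u \<bullet> b) * (v \<bullet> b) * K u v - c * q u * (v \<bullet> b) * K1 b u v
        - c * q v * (u \<bullet> b) * K2 b u v + c\<^sup>2 * q u * q v * K12 b u v)"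
  using assms(1)
proof (induction K rule: psd_kernel.induct)
  case zero
  show ?case
    by (intro exI[of _ "\<lambda>b u v. 0"]) (auto intro: psd_kernel.zero)
next
  case (rank1_add f K)
  from rank1_add.IH obtain K1 K2 K12 where K1: "\<And>b u v. ((\<lambda>h. K (u + h *\<^sub>R b) v) has_real_derivative K1 b u v) (at 0)"
    and K2: "\<And>b u v. ((\<lambda>h. K u (v + h *\<^sub>R b)) has_real_derivative K2 b u v) (at 0)"
    and K12: "\<And>b u v. ((\<lambda>h. K1 b u (v + h *\<^sub>R b)) has_real_derivative K12 b u v) (at 0)"
    and psd: "psd_kernel (\<lambda>u v. \<Sum>b\<in>B. (u \<bullet> b) * (v \<bullet> b) * K u v - c * q u * (v \<bullet> b) * K1 b u v
        - c * q v * (u \<bullet> b) * K2 b u v + c\<^sup>2 * q u * q v * K12 b u v)"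
    by blast
  obtain f' where f': "\<And>b. real_polynomial_function (f' b)"
    "\<And>b u. ((\<lambda>h. f (u + h *\<^sub>R b)) has_real_derivative f' b u) (at 0)"
    using real_polynomial_function_directional_derivative[OF rank1_add.hyps(1)] by blast
  let ?g = "\<lambda>b u. (u \<bullet> b) * f u - c * q u * f' b u"
  have "real_polynomial_function (?g b)" for b
    using f'(1) rank1_add.hyps(1) assms(3)
    by (intro real_polynomial_function_diff real_polynomial_function.intros(2-) real_polynomial_function.intros(1)[OF bounded_linear_inner_left])
  then have "psd_kernel (\<lambda>u v. \<Sum>b\<in>B. ?g b u * ?g b v)"
    using assms(2) by (intro psd_kernel_sum psd_kernel_rank1)
  from psd_kernel_add[OF this psd]
  have "psd_kernel (\<lambda>u v. \<Sum>b\<in>B. (u \<bullet> b) * (v \<bullet> b) * (f u * f v + K u v)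
        - c * q u * (v \<bullet> b) * (f' b u * f v + K1 b u v)
        - c * q v * (u \<bullet> b) * (f u * f' b v + K2 b u v) + c\<^sup>2 * q u * q v * (f' b u * f' b v + K12 b u v))"
    by (simp add: algebra_simps power2_eq_square flip: sum.distrib)
  then show ?case
    using f'(2) K1 K2 K12
    by (intro exI[of _ "\<lambda>b u v. f' b u * f v + K1 b u v"] exI[of _ "\<lambda>b u v. f u * f' b v + K2 b u v"]
        exI[of _ "\<lambda>b u v. f' b u * f' b v + K12 b u v"] conjI allI DERIV_add)
      (auto intro: DERIV_cmult DERIV_cmult_right)
qed

section \<open>Zonal kernels and the identity behind the raising step\<close>

lemma sum_atMost_shift2:
  fixes f :: "nat \<Rightarrow> real"
  assumes "f 0 = 0" "f 1 = 0" "f (l + 1) = 0" "f (l + 2) = 0"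
  shows "(\<Sum>i\<le>l. f i) = (\<Sum>i\<le>l. f (i + 2))"
proof -
  have "(\<Sum>i\<le>l. f i) = (\<Sum>i\<le>Suc (Suc l). f i)" using assms by simp
  also have "\<dots> = (\<Sum>i\<le>l. f (i + 2))"
    using assms by (simp only: sum.atMost_Suc_shift) simp
  finally show ?thesis .
qed

text \<open>The left-hand side is what raising makes of \<open>geg_hom m l\<close>, monomial by
  monomial (\<open>zonal_monom_raise\<close> with m basis vectors); c is the constant of the
  harmonic projection in degree l. With D = l + m - 2 one has c (D + l) = 1. The difference from c D
  times the polynomial of degree l + 1 is c^2 times a sum that vanishes by
  \<open>coeff_geg_rec\<close>.\<close>

lemma geg_hom_Suc:
  assumes "m \<ge> 2" "l > 0"
  defines "c \<equiv> 1 / (real m + 2 * real l - 2)"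
  shows "(\<Sum>i\<le>l. coeff (geg m l) i * ((1 - 2 * c * real ((l - i) div 2))\<^sup>2 * (t ^ Suc i * r ^ ((l - i) div 2))
       + (c\<^sup>2 * real i * (real i - 1 + real m + 4 * real ((l - i) div 2)) - 2 * c * real i)
          * (t ^ (i - 1) * r ^ Suc ((l - i) div 2))))
    = (real m + real l - 2) / (real m + 2 * real l - 2) * geg_hom m (Suc l) t r"
proof -
  define a where "a = coeff (geg m l)"
  define D where "D = real l + real m - 2"
  \<comment> \<open>The two families overlap: A i = B (i + 2) for i + 2 \<le> l. This shift by two
    matches the step of \<open>coeff_geg_rec\<close>.\<close>
  define A where "A i = t ^ Suc i * r ^ ((l - i) div 2)" for i
  define B where "B i = t ^ (i - 1) * r ^ Suc ((l - i) div 2)" for i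
  have D: "D > 0" using assms by (simp add: D_def)
  have a0: "a i = 0" if "i > l \<or> odd (l + i)" for i
    using that degree_geg[OF assms(1), of l] coeff_geg_parity[of l i m] by (auto simp: a_def coeff_eq_0)
  have c: "c * (D + real l) = 1" using D by (simp add: c_def D_def)
  have lhs: "a i * ((1 - 2 * c * real ((l - i) div 2))\<^sup>2 * A i
       + (c\<^sup>2 * real i * (real i - 1 + real m + 4 * real ((l - i) div 2)) - 2 * c * real i) * B i) =
     a i * (c\<^sup>2 * (D + real i)\<^sup>2 * A i - c\<^sup>2 * real i * (D + real l + real i - 1) * B i)"
    if "i \<le> l" for i
  \<comment> \<open>For odd l + i the coefficient is 0. For even l + i the halving is exact, and 1 -
    c (l - i) = c (D + i) because c (D + l) = 1.\<close>
  proof (cases "even (l + i)")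
    case True
    then have j: "2 * real ((l - i) div 2) = real l - real i"
      using that by (metis (no_types, lifting) dvd_mult_div_cancel even_add even_diff_nat of_nat_diff of_nat_mult of_nat_numeral)
    then have j4: "4 * real ((l - i) div 2) = 2 * (real l - real i)" by simp
    have "1 - 2 * c * real ((l - i) div 2) = 1 - c * (real l - real i)"
      unfolding j[symmetric] by simp
    also have "\<dots> = c * (D + real i)" using c by (simp add: algebra_simps)
    finally have 1: "1 - 2 * c * real ((l - i) div 2) = c * (D + real i)" .
    have "c\<^sup>2 * real i * (real i - 1 + real m + 4 * real ((l - i) div 2)) - 2 * c * real i
      = c\<^sup>2 * real i * (D + real l - real i + 1) - 2 * c * real i * (c * (D + real l))"
      unfolding c j4 by (simp add: D_def algebra_simps)
    also have "\<dots> = - (c\<^sup>2 * real i * (D + real l + real i - 1))"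
      by (simp add: algebra_simps power2_eq_square)
    finally show ?thesis unfolding 1 by (simp add: power_mult_distrib)
  next
    case False
    then show ?thesis by (simp add: a0)
  qed
  have "geg_hom m (Suc l) t r =
     (\<Sum>i\<le>Suc l. (if i = 0 then 0 else (1 + (real i - 1) / D) * a (i - 1)) * t ^ i * r ^ ((Suc l - i) div 2))
     - (\<Sum>i\<le>Suc l. (real i + 1) / D * a (Suc i) * t ^ i * r ^ ((Suc l - i) div 2))"
    by (simp only: geg_hom_def coeff_geg_Suc a_def D_def left_diff_distrib sum_subtractf)
  also have "(\<Sum>i\<le>Suc l. (if i = 0 then 0 else (1 + (real i - 1) / D) * a (i - 1)) * t ^ i * r ^ ((Suc l - i) div 2))
     = (\<Sum>i\<le>l. (1 + real i / D) * a i * A i)"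
    unfolding sum.atMost_Suc_shift by (simp add: A_def mult.assoc)
  also have "(\<Sum>i\<le>Suc l. (real i + 1) / D * a (Suc i) * t ^ i * r ^ ((Suc l - i) div 2))
     = (\<Sum>i\<le>Suc (Suc l). real i / D * a i * t ^ (i - 1) * r ^ ((Suc (Suc l) - i) div 2))"
    unfolding sum.atMost_Suc_shift[of _ "Suc l"] by (simp add: add.commute)
  also have "\<dots> = (\<Sum>i\<le>l. real i / D * a i * t ^ (i - 1) * r ^ ((Suc (Suc l) - i) div 2))"
    by (simp add: a0)
  also have "\<dots> = (\<Sum>i\<le>l. real i / D * a i * B i)"
    by (intro sum.cong) (auto simp: B_def Suc_diff_le)
  finally have hom: "geg_hom m (Suc l) t r = (\<Sum>i\<le>l. (1 + real i / D) * a i * A i) - (\<Sum>i\<le>l. real i / D * a i * B i)" .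
  have cD: "c * D * geg_hom m (Suc l) t r =
      (\<Sum>i\<le>l. c * (D + real i) * a i * A i) - (\<Sum>i\<le>l. c * real i * a i * B i)"
    unfolding hom right_diff_distrib sum_distrib_left
    by (intro arg_cong2[where f = "(-)"] sum.cong refl) (use D in \<open>simp_all add: field_simps\<close>)
  have "(\<Sum>i\<le>l. real i * (real i - 1) * a i * B i) = (\<Sum>i\<le>l. real (i + 2) * (real (i + 2) - 1) * a (i + 2) * B (i + 2))"
    by (rule sum_atMost_shift2) (auto simp: a0)
  also have "\<dots> = (\<Sum>i\<le>l. (real i - real l) * (D + real i) * a i * A i)"
  proof (intro sum.cong refl)
    fix i assume "i \<in> {..l}"
    have rec: "real (i + 2) * (real (i + 2) - 1) * a (i + 2) = (real i - real l) * (D + real i) * a i"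
      using coeff_geg_rec[OF assms(1), of i l] by (simp add: a_def D_def algebra_simps)
    show "real (i + 2) * (real (i + 2) - 1) * a (i + 2) * B (i + 2) = (real i - real l) * (D + real i) * a i * A i"
    proof (cases "i + 2 \<le> l")
      case True
      then have "l - i = Suc (Suc (l - (i + 2)))" by simp
      then have "A i = B (i + 2)" by (simp add: A_def B_def)
      then show ?thesis by (simp only: rec)
    next
      \<comment> \<open>At the upper end the right-hand side vanishes, by its first factor for i = l
        and by parity for i = l - 1.\<close>
      case False
      with \<open>i \<in> {..l}\<close> have "i = l \<or> Suc i = l" by auto
      then have "(real i - real l) * (D + real i) * a i = 0"
        by (auto simp: a0)
      then show ?thesis by (simp only: rec mult_zero_left)
    qed
  qed
  finally have tele: "(\<Sum>i\<le>l. real i * (real i - 1) * a i * B i) = (\<Sum>i\<le>l. (real i - real l) * (D + real i) * a i * A i)" .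
  have "(\<Sum>i\<le>l. a i * (c\<^sup>2 * (D + real i)\<^sup>2 * A i - c\<^sup>2 * real i * (D + real l + real i - 1) * B i))
     - c * D * geg_hom m (Suc l) t r
     = (\<Sum>i\<le>l. a i * (c\<^sup>2 * (D + real i)\<^sup>2 * A i - c\<^sup>2 * real i * (D + real l + real i - 1) * B i)
         - c * (D + real i) * a i * A i + c * real i * a i * B i)"
    unfolding cD by (simp add: sum_subtractf sum.distrib)
  also have "\<dots> = (\<Sum>i\<le>l. c\<^sup>2 * ((real i - real l) * (D + real i) * a i * A i) - c\<^sup>2 * (real i * (real i - 1) * a i * B i))"
  proof (intro sum.cong refl)
    fix i
    \<comment> \<open>Multiplying by c (D + l) = 1 gives all terms the common factor c^2.\<close>
    have "c * x = c\<^sup>2 * (D + real l) * x" for x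
      using c by (simp add: power2_eq_square mult.assoc)
    from this[of "(D + real i) * a i * A i"] this[of "real i * a i * B i"]
    show "a i * (c\<^sup>2 * (D + real i)\<^sup>2 * A i - c\<^sup>2 * real i * (D + real l + real i - 1) * B i)
         - c * (D + real i) * a i * A i + c * real i * a i * B i
       = c\<^sup>2 * ((real i - real l) * (D + real i) * a i * A i) - c\<^sup>2 * (real i * (real i - 1) * a i * B i)"
      by (simp add: algebra_simps power2_eq_square)
  qed
  also have "\<dots> = 0"
    unfolding sum_subtractf sum_distrib_left[symmetric] tele by simp
  finally have "(\<Sum>i\<le>l. a i * (c\<^sup>2 * (D + real i)\<^sup>2 * A i - c\<^sup>2 * real i * (D + real l + real i - 1) * B i))
     = c * D * geg_hom m (Suc l) t r" by simp
  moreover have "c * D = (real m + real l - 2) / (real m + 2 * real l - 2)" by (simp add: c_def D_def add.commute)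
  moreover have "(\<Sum>i\<le>l. a i * ((1 - 2 * c * real ((l - i) div 2))\<^sup>2 * A i
       + (c\<^sup>2 * real i * (real i - 1 + real m + 4 * real ((l - i) div 2)) - 2 * c * real i) * B i)) =
     (\<Sum>i\<le>l. a i * (c\<^sup>2 * (D + real i)\<^sup>2 * A i - c\<^sup>2 * real i * (D + real l + real i - 1) * B i))"
    by (intro sum.cong refl lhs) simp
  ultimately show ?thesis
    unfolding a_def[symmetric] A_def[symmetric] B_def[symmetric] by (simp only:)
qed

text \<open>For orthonormal B, the inner product of the projections to the span of B. Kernels on a
  hyperplane thus become kernels on the whole space, and no type for the hyperplane is
  needed.\<close>

definition ip_on :: "'a::real_inner set \<Rightarrow> 'a \<Rightarrow> 'a \<Rightarrow> real" where
  "ip_on B u v = (\<Sum>b\<in>B. (u \<bullet> b) * (v \<bullet> b))"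

lemma ip_on_commute: "ip_on B u v = ip_on B v u"
  by (simp add: ip_on_def mult.commute)

definition orthonormal :: "'a::real_inner set \<Rightarrow> bool" where
  "orthonormal B \<longleftrightarrow> finite B \<and> (\<forall>b\<in>B. \<forall>b'\<in>B. b \<bullet> b' = (if b = b' then 1 else 0))"

lemma ip_on_shift:
  assumes "orthonormal B" "b \<in> B"
  shows "ip_on B (u + h *\<^sub>R b) v = ip_on B u v + h * (v \<bullet> b)"
    and "ip_on B v (u + h *\<^sub>R b) = ip_on B u v + h * (v \<bullet> b)"
proof -
  have "ip_on B (u + h *\<^sub>R b) v = ip_on B u v + h * (\<Sum>b'\<in>B. (b \<bullet> b') * (v \<bullet> b'))"
    by (simp add: ip_on_def inner_add_left algebra_simps sum.distrib sum_distrib_left)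
  also have "(\<Sum>b'\<in>B. (b \<bullet> b') * (v \<bullet> b')) = (\<Sum>b'\<in>B. if b' = b then v \<bullet> b else 0)"
    using assms by (intro sum.cong) (auto simp: orthonormal_def)
  also have "\<dots> = v \<bullet> b"
    using assms by (simp add: orthonormal_def)
  finally show "ip_on B (u + h *\<^sub>R b) v = ip_on B u v + h * (v \<bullet> b)" .
  then show "ip_on B v (u + h *\<^sub>R b) = ip_on B u v + h * (v \<bullet> b)"
    by (simp add: ip_on_commute[of B v])
qed

lemma ip_on_shift_self:
  assumes "orthonormal B" "b \<in> B"
  shows "ip_on B (u + h *\<^sub>R b) (u + h *\<^sub>R b) = ip_on B u u + 2 * h * (u \<bullet> b) + h\<^sup>2"
proof -
  have "b \<bullet> b = 1" using assms by (auto simp: orthonormal_def)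
  then show ?thesis
    by (simp add: ip_on_shift[OF assms] inner_add_left algebra_simps power2_eq_square)
qed

context
  fixes B :: "'a::real_inner set"
  assumes B: "orthonormal B"
begin

lemma ip_on_derivs:
  assumes b: "b \<in> B"
  shows "((\<lambda>h. ip_on B (u + h *\<^sub>R b) v) has_real_derivative v \<bullet> b) (at 0)"
    and "((\<lambda>h. ip_on B u (v + h *\<^sub>R b)) has_real_derivative u \<bullet> b) (at 0)"
    and "((\<lambda>h. ip_on B (u + h *\<^sub>R b) (u + h *\<^sub>R b)) has_real_derivative 2 * (u \<bullet> b)) (at 0)"
    and "((\<lambda>h. (v + h *\<^sub>R b) \<bullet> b) has_real_derivative 1) (at 0)"
proof -
  show "((\<lambda>h. ip_on B (u + h *\<^sub>R b) v) has_real_derivative v \<bullet> b) (at 0)"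
    "((\<lambda>h. ip_on B u (v + h *\<^sub>R b)) has_real_derivative u \<bullet> b) (at 0)"
    unfolding ip_on_shift[OF B b] by (auto intro!: derivative_eq_intros)
  show "((\<lambda>h. ip_on B (u + h *\<^sub>R b) (u + h *\<^sub>R b)) has_real_derivative 2 * (u \<bullet> b)) (at 0)"
    unfolding ip_on_shift_self[OF B b] by (auto intro!: derivative_eq_intros)
  have "b \<bullet> b = 1" using B b by (auto simp: orthonormal_def)
  then show "((\<lambda>h. (v + h *\<^sub>R b) \<bullet> b) has_real_derivative 1) (at 0)"
    by (auto simp: inner_add_left intro!: derivative_eq_intros)
qed

definition zonal_monom :: "nat \<Rightarrow> nat \<Rightarrow> 'a \<Rightarrow> 'a \<Rightarrow> real" where
  "zonal_monom i j u v = ip_on B u v ^ i * (ip_on B u u * ip_on B v v) ^ j"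

definition zonal_monom_deriv :: "nat \<Rightarrow> nat \<Rightarrow> 'a \<Rightarrow> 'a \<Rightarrow> 'a \<Rightarrow> real" where
  "zonal_monom_deriv i j b u v = real i * ip_on B u v ^ (i - 1) * (v \<bullet> b) * (ip_on B u u * ip_on B v v) ^ j
     + ip_on B u v ^ i * (real j * (ip_on B u u * ip_on B v v) ^ (j - 1) * (2 * (u \<bullet> b) * ip_on B v v))"

text \<open>The mixed derivative in direction b, once in u and once in v. Wherever an exponent such
  as i - 2 is truncated, one of the factors in front is 0.\<close>

definition zonal_monom_deriv2 :: "nat \<Rightarrow> nat \<Rightarrow> 'a \<Rightarrow> 'a \<Rightarrow> 'a \<Rightarrow> real" where
  "zonal_monom_deriv2 i j b u v = (let t = ip_on B u v; p = ip_on B u u; q = ip_on B v v; r = p * q; x = u \<bullet> b; y = v \<bullet> b in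
      real i * real (i - 1) * t ^ (i - 2) * x * y * r ^ j + real i * t ^ (i - 1) * r ^ j
    + real i * t ^ (i - 1) * y * (real j * r ^ (j - 1) * (2 * y * p))
    + real i * t ^ (i - 1) * x * (real j * r ^ (j - 1) * (2 * x * q))
    + t ^ i * real j * real (j - 1) * r ^ (j - 2) * (2 * y * p) * (2 * x * q)
    + t ^ i * real j * r ^ (j - 1) * (2 * x) * (2 * y))"

lemma zonal_monom_has_deriv1:
  assumes b: "b \<in> B"
  shows "((\<lambda>h. zonal_monom i j (u + h *\<^sub>R b) v) has_real_derivative zonal_monom_deriv i j b u v) (at 0)"
  unfolding zonal_monom_def zonal_monom_deriv_def
  by (rule derivative_eq_intros ip_on_derivs b refl)+ simp

lemma zonal_monom_commute: "zonal_monom i j u v = zonal_monom i j v u"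
  by (simp add: zonal_monom_def ip_on_commute[of B u v] mult.commute)

lemma zonal_monom_has_deriv2:
  assumes b: "b \<in> B"
  shows "((\<lambda>h. zonal_monom i j u (v + h *\<^sub>R b)) has_real_derivative zonal_monom_deriv i j b v u) (at 0)"
  unfolding zonal_monom_commute[of i j u] by (rule zonal_monom_has_deriv1[OF b])

lemma zonal_monom_has_deriv12:
  assumes b: "b \<in> B"
  shows "((\<lambda>h. zonal_monom_deriv i j b u (v + h *\<^sub>R b)) has_real_derivative zonal_monom_deriv2 i j b u v) (at 0)"
  unfolding zonal_monom_deriv_def zonal_monom_deriv2_def Let_def
  by (rule derivative_eq_intros ip_on_derivs b refl)+ (simp add: algebra_simps numeral_2_eq_2)

text \<open>Summing over b turns products of coordinates into t, p or q. Differentiating the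
  coordinate v_b itself leaves a term constant in b, which yields \<open>card B\<close>; this is how
  the dimension enters. The monomial t^i r^j becomes a combination of t^(i+1) r^j and t^(i-1)
  r^(j+1) only.\<close>

lemma zonal_monom_raise:
  "(\<Sum>b\<in>B. (u \<bullet> b) * (v \<bullet> b) * zonal_monom i j u v - c * ip_on B u u * (v \<bullet> b) * zonal_monom_deriv i j b u v
        - c * ip_on B v v * (u \<bullet> b) * zonal_monom_deriv i j b v u + c\<^sup>2 * ip_on B u u * ip_on B v v * zonal_monom_deriv2 i j b u v) =
     (1 - 2 * c * real j)\<^sup>2 * (ip_on B u v ^ Suc i * (ip_on B u u * ip_on B v v) ^ j)
     + (c\<^sup>2 * real i * (real i - 1 + real (card B) + 4 * real j) - 2 * c * real i)
          * (ip_on B u v ^ (i - 1) * (ip_on B u u * ip_on B v v) ^ Suc j)"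
proof -
  define t where "t = ip_on B u v"
  define p where "p = ip_on B u u"
  define q where "q = ip_on B v v"
  define r where "r = p * q"
  have t: "(\<Sum>b\<in>B. X * ((u \<bullet> b) * (v \<bullet> b))) = X * t" for X
    by (simp add: t_def ip_on_def sum_distrib_left)
  have p: "(\<Sum>b\<in>B. X * ((u \<bullet> b) * (u \<bullet> b))) = X * p" for X
    by (simp add: p_def ip_on_def sum_distrib_left)
  have q: "(\<Sum>b\<in>B. X * ((v \<bullet> b) * (v \<bullet> b))) = X * q" for X
    by (simp add: q_def ip_on_def sum_distrib_left)
  have vu: "ip_on B v u = t" by (simp add: t_def ip_on_commute)
  \<comment> \<open>First and second derivatives of the powers t^i and r^j. The relations below
    multiply one factor back in and so absorb the truncated exponents.\<close>
  define e1 where "e1 = real i * t ^ (i - 1)"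
  define e2 where "e2 = real i * real (i - 1) * t ^ (i - 2)"
  define r1 where "r1 = real j * r ^ (j - 1)"
  define r2 where "r2 = real j * real (j - 1) * r ^ (j - 2)"
  have e1: "e1 * t = real i * t ^ i" by (cases i) (simp_all add: e1_def)
  have e2: "e2 * t = (real i - 1) * e1"
    by (cases i; cases "i - 1") (simp_all add: e1_def e2_def)
  have r1: "r1 * r = real j * r ^ j" by (cases j) (simp_all add: r1_def)
  have r2: "r2 * r = (real j - 1) * r1"
    by (cases j; cases "j - 1") (simp_all add: r1_def r2_def)
  have "(\<Sum>b\<in>B. (u \<bullet> b) * (v \<bullet> b) * zonal_monom i j u v - c * p * (v \<bullet> b) * zonal_monom_deriv i j b u v
        - c * q * (u \<bullet> b) * zonal_monom_deriv i j b v u + c\<^sup>2 * p * q * zonal_monom_deriv2 i j b u v) =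
     (\<Sum>b\<in>B. (t ^ i * r ^ j) * ((u \<bullet> b) * (v \<bullet> b)) 
       - (c * p * e1 * r ^ j) * ((v \<bullet> b) * (v \<bullet> b)) - (c * p * t ^ i * r1 * 2 * q) * ((u \<bullet> b) * (v \<bullet> b))
       - (c * q * e1 * r ^ j) * ((u \<bullet> b) * (u \<bullet> b)) - (c * q * t ^ i * r1 * 2 * p) * ((u \<bullet> b) * (v \<bullet> b))
       + (c\<^sup>2 * r * e2 * r ^ j) * ((u \<bullet> b) * (v \<bullet> b)) + c\<^sup>2 * r * e1 * r ^ j
       + (c\<^sup>2 * r * e1 * r1 * 2 * p) * ((v \<bullet> b) * (v \<bullet> b))
       + (c\<^sup>2 * r * e1 * r1 * 2 * q) * ((u \<bullet> b) * (u \<bullet> b))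
       + (c\<^sup>2 * r * t ^ i * r2 * 4 * r) * ((u \<bullet> b) * (v \<bullet> b))
       + (c\<^sup>2 * r * t ^ i * r1 * 4) * ((u \<bullet> b) * (v \<bullet> b)))"
    unfolding zonal_monom_def zonal_monom_deriv_def zonal_monom_deriv2_def Let_def vu t_def[symmetric] p_def[symmetric] q_def[symmetric]
      r_def[symmetric] mult.commute[of q p] e1_def e2_def r1_def r2_def
    by (intro sum.cong refl) (simp add: algebra_simps r_def)
  also have "\<dots> = t ^ i * r ^ j * t - c * p * e1 * r ^ j * q - c * p * t ^ i * r1 * 2 * q * t
       - c * q * e1 * r ^ j * p - c * q * t ^ i * r1 * 2 * p * t
       + c\<^sup>2 * r * e2 * r ^ j * t + real (card B) * (c\<^sup>2 * r * e1 * r ^ j)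
       + c\<^sup>2 * r * e1 * r1 * 2 * p * q + c\<^sup>2 * r * e1 * r1 * 2 * q * p
       + c\<^sup>2 * r * t ^ i * r2 * 4 * r * t + c\<^sup>2 * r * t ^ i * r1 * 4 * t"
    unfolding sum.distrib sum_subtractf t p q sum_constant ..
  also have "\<dots> = t ^ i * r ^ j * t - 2 * c * e1 * r ^ j * r - 4 * c * t ^ i * (r1 * r) * t
       + c\<^sup>2 * r * (e2 * t) * r ^ j + real (card B) * (c\<^sup>2 * r * e1 * r ^ j)
       + 4 * c\<^sup>2 * r * e1 * (r1 * r)
       + 4 * c\<^sup>2 * r * t ^ i * (r2 * r) * t + 4 * c\<^sup>2 * (r1 * r) * t ^ i * t"
    by (simp add: r_def algebra_simps)
  also have "\<dots> = t ^ i * r ^ j * t - 2 * c * e1 * r ^ j * r - 4 * c * t ^ i * (r1 * r) * t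
       + c\<^sup>2 * r * (e2 * t) * r ^ j + real (card B) * (c\<^sup>2 * r * e1 * r ^ j)
       + 4 * c\<^sup>2 * r * e1 * (r1 * r)
       + 4 * c\<^sup>2 * t ^ i * (real j - 1) * (r1 * r) * t + 4 * c\<^sup>2 * (r1 * r) * t ^ i * t"
    unfolding r2 by (simp add: algebra_simps)
  also have "\<dots> = (1 - 2 * c * real j)\<^sup>2 * (t ^ Suc i * r ^ j)
     + (c\<^sup>2 * (real i - 1 + real (card B) + 4 * real j) - 2 * c) * e1 * r ^ Suc j"
    unfolding r1 e2 by (simp add: algebra_simps power2_eq_square)
  also have "\<dots> = (1 - 2 * c * real j)\<^sup>2 * (t ^ Suc i * r ^ j)
     + (c\<^sup>2 * real i * (real i - 1 + real (card B) + 4 * real j) - 2 * c * real i) * (t ^ (i - 1) * r ^ Suc j)"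
    by (simp add: e1_def algebra_simps)
  finally show ?thesis unfolding t_def p_def q_def r_def .
qed

lemma real_polynomial_function_ip_on: "real_polynomial_function (\<lambda>u. ip_on B u u)"
  unfolding ip_on_def using B
  by (intro real_polynomial_function_sum real_polynomial_function.intros(4)
      real_polynomial_function.intros(1)[OF bounded_linear_inner_left]) (simp add: orthonormal_def)

text \<open>The harmonic projection of $u_b \varphi(u)$, for $\varphi$ harmonic and homogeneous of degree $l$, is
  $u_b \varphi - |u|^2 \partial_b \varphi / (m + 2l - 2)$. Applied in both arguments of the degree $l$ kernel
  and summed over an orthonormal basis, it yields a positive multiple of the degree $l + 1$ kernel.\<close>

lemma psd_kernel_geg_hom:
  assumes "card B \<ge> 2"
  shows "psd_kernel (\<lambda>u v. geg_hom (card B) k (ip_on B u v) (ip_on B u u * ip_on B v v))"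
proof (induction k)
  case 0
  have "psd_kernel (\<lambda>u v :: 'a. 1 * 1)"
    by (rule psd_kernel_rank1) (rule real_polynomial_function.intros)
  then show ?case by (simp add: geg_hom_def)
next
  case (Suc l)
  let ?m = "card B"
  show ?case
  \<comment> \<open>For m = 2 and l = 0 the constant c would have denominator 0. Degree 1 is direct:
    its kernel is \<open>ip_on B u v\<close>.\<close>
  proof (cases "l = 0")
    case True
    have "psd_kernel (\<lambda>u v. \<Sum>b\<in>B. (u \<bullet> b) * (v \<bullet> b))"
      using B by (intro psd_kernel_sum psd_kernel_rank1 real_polynomial_function.intros(1) bounded_linear_inner_left)
        (simp add: orthonormal_def)
    then show ?thesis
      using True by (simp add: geg_hom_def geg_1 coeff_pCons ip_on_def)
  next
    case False
    define c where "c = 1 / (real ?m + 2 * real l - 2)"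
    define a where "a i = coeff (geg ?m l) i" for i
    define s where "s i = (l - i) div 2" for i
    define K where "K u v = geg_hom ?m l (ip_on B u v) (ip_on B u u * ip_on B v v)" for u v
    have K_eq: "K u v = (\<Sum>i\<le>l. a i * zonal_monom i (s i) u v)" for u v
      by (simp add: K_def geg_hom_def a_def s_def zonal_monom_def mult.assoc)
    from psd_kernel_raise[OF Suc.IH _ real_polynomial_function_ip_on, of B c] B
    obtain K1 K2 K12 where K1: "\<And>b u v. ((\<lambda>h. K (u + h *\<^sub>R b) v) has_real_derivative K1 b u v) (at 0)"
      and K2: "\<And>b u v. ((\<lambda>h. K u (v + h *\<^sub>R b)) has_real_derivative K2 b u v) (at 0)"
      and K12: "\<And>b u v. ((\<lambda>h. K1 b u (v + h *\<^sub>R b)) has_real_derivative K12 b u v) (at 0)"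
      and psd: "psd_kernel (\<lambda>u v. \<Sum>b\<in>B. (u \<bullet> b) * (v \<bullet> b) * K u v - c * ip_on B u u * (v \<bullet> b) * K1 b u v
        - c * ip_on B v v * (u \<bullet> b) * K2 b u v + c\<^sup>2 * ip_on B u u * ip_on B v v * K12 b u v)"
      unfolding K_def orthonormal_def by blast
    \<comment> \<open>The derivatives were obtained from an unknown decomposition of
      \<open>K\<close>; uniqueness of derivatives identifies them with those of the
      monomials.\<close>
    have K1_eq: "K1 b u v = (\<Sum>i\<le>l. a i * zonal_monom_deriv i (s i) b u v)" if "b \<in> B" for b u v
      by (rule DERIV_unique[OF K1]) (simp only: K_eq, intro DERIV_sum DERIV_cmult zonal_monom_has_deriv1[OF that])
    have K2_eq: "K2 b u v = (\<Sum>i\<le>l. a i * zonal_monom_deriv i (s i) b v u)" if "b \<in> B" for b u v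
      by (rule DERIV_unique[OF K2]) (simp only: K_eq, intro DERIV_sum DERIV_cmult zonal_monom_has_deriv2[OF that])
    have K12_eq: "K12 b u v = (\<Sum>i\<le>l. a i * zonal_monom_deriv2 i (s i) b u v)" if "b \<in> B" for b u v
      by (rule DERIV_unique[OF K12]) (simp only: K1_eq[OF that], intro DERIV_sum DERIV_cmult zonal_monom_has_deriv12[OF that])
    have "(\<Sum>b\<in>B. (u \<bullet> b) * (v \<bullet> b) * K u v - c * ip_on B u u * (v \<bullet> b) * K1 b u v
        - c * ip_on B v v * (u \<bullet> b) * K2 b u v + c\<^sup>2 * ip_on B u u * ip_on B v v * K12 b u v) =
      (real ?m + real l - 2) / (real ?m + 2 * real l - 2) *
        geg_hom ?m (Suc l) (ip_on B u v) (ip_on B u u * ip_on B v v)" for u v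
    proof -
      have "(\<Sum>b\<in>B. (u \<bullet> b) * (v \<bullet> b) * K u v - c * ip_on B u u * (v \<bullet> b) * K1 b u v
        - c * ip_on B v v * (u \<bullet> b) * K2 b u v + c\<^sup>2 * ip_on B u u * ip_on B v v * K12 b u v) =
        (\<Sum>b\<in>B. \<Sum>i\<le>l. a i * ((u \<bullet> b) * (v \<bullet> b) * zonal_monom i (s i) u v - c * ip_on B u u * (v \<bullet> b) * zonal_monom_deriv i (s i) b u v
        - c * ip_on B v v * (u \<bullet> b) * zonal_monom_deriv i (s i) b v u + c\<^sup>2 * ip_on B u u * ip_on B v v * zonal_monom_deriv2 i (s i) b u v))"
        by (intro sum.cong refl)
          (simp add: K_eq K1_eq K2_eq K12_eq right_diff_distrib distrib_left sum.distrib sum_subtractf sum_distrib_left mult_ac)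
      also have "\<dots> = (\<Sum>i\<le>l. a i * (\<Sum>b\<in>B. (u \<bullet> b) * (v \<bullet> b) * zonal_monom i (s i) u v - c * ip_on B u u * (v \<bullet> b) * zonal_monom_deriv i (s i) b u v
        - c * ip_on B v v * (u \<bullet> b) * zonal_monom_deriv i (s i) b v u + c\<^sup>2 * ip_on B u u * ip_on B v v * zonal_monom_deriv2 i (s i) b u v))"
        by (subst sum.swap) (simp only: sum_distrib_left)
      also have "\<dots> = (real ?m + real l - 2) / (real ?m + 2 * real l - 2) *
        geg_hom ?m (Suc l) (ip_on B u v) (ip_on B u u * ip_on B v v)"
        unfolding zonal_monom_raise a_def s_def c_def
        using False by (intro geg_hom_Suc[OF assms]) simp
      finally show ?thesis .
    qed
    with psd have psd': "psd_kernel (\<lambda>u v. (real ?m + real l - 2) / (real ?m + 2 * real l - 2) *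
        geg_hom ?m (Suc l) (ip_on B u v) (ip_on B u u * ip_on B v v))" by simp
    \<comment> \<open>The factor gained by raising is positive, so its reciprocal may be used in
      \<open>psd_kernel_scale\<close>.\<close>
    have pos: "real ?m + real l - 2 > 0" "real ?m + 2 * real l - 2 > 0" using assms False by auto
    have "psd_kernel (\<lambda>u v. (real ?m + 2 * real l - 2) / (real ?m + real l - 2) *
        ((real ?m + real l - 2) / (real ?m + 2 * real l - 2) *
        geg_hom ?m (Suc l) (ip_on B u v) (ip_on B u u * ip_on B v v)))"
      by (rule psd_kernel_scale[OF psd']) (use pos in simp)
    then show ?thesis using pos by simp
  qed
qed

end

subsection \<open>Sums over the triples of a code\<close>

text \<open>Expand the projection u - (u . w) w in an orthonormal basis of the hyperplane. With x =
  u . w, y = v . w, z = u . v the formula reads z - x y, and for a unit vector u it gives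
  \<open>ip_on B u u\<close> = 1 - x^2: the arguments of \<open>geg_hom\<close> in
  \<open>Y_entry_eq\<close>.\<close>

lemma orthonormal_complement_basis:
  fixes w :: "'a::euclidean_space"
  assumes "norm w = 1"
  obtains B where "orthonormal B" "card B = DIM('a) - 1"
    "\<And>u v. ip_on B u v = u \<bullet> v - (u \<bullet> w) * (v \<bullet> w)"
proof -
  have w: "w \<noteq> 0" "w \<bullet> w = 1" using assms by (auto simp: norm_eq_1)
  obtain B where B: "B \<subseteq> {x. w \<bullet> x = 0}" "pairwise orthogonal B" "\<And>x. x \<in> B \<Longrightarrow> norm x = 1"
    "finite B" "card B = dim {x. w \<bullet> x = 0}" "span B = {x. w \<bullet> x = 0}"
    by (metis orthonormal_basis_subspace[OF subspace_hyperplane[of w]] independent_imp_finite)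
  have on: "orthonormal B"
    using B(2-4) by (auto simp: orthonormal_def pairwise_def real_inner_class.orthogonal_def norm_eq_1)
  have "ip_on B u v = u \<bullet> v - (u \<bullet> w) * (v \<bullet> w)" for u v
  proof -
    define u' where "u' = u - (u \<bullet> w) *\<^sub>R w"
    have "u' \<in> span B"
      using w by (simp add: B(6) u'_def inner_diff_right inner_commute)
    then have e: "(\<Sum>b\<in>B. (u' \<bullet> b) *\<^sub>R b) = u'"
      using B(2-4) by (intro orthonormal_basis_expand)
    have "u' \<bullet> b = u \<bullet> b" if "b \<in> B" for b
      using that B(1) by (auto simp: u'_def inner_diff_left)
    then have "ip_on B u v = (\<Sum>b\<in>B. (u' \<bullet> b) *\<^sub>R b) \<bullet> v"
      by (simp add: ip_on_def inner_sum_left) (simp add: inner_commute)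
    also have "\<dots> = u \<bullet> v - (u \<bullet> w) * (v \<bullet> w)"
      unfolding e by (simp add: u'_def inner_diff_left inner_commute[of w])
    finally show ?thesis .
  qed
  with on B(5) w(1) show thesis
    by (intro that) (auto simp: dim_hyperplane)
qed

lemma mat_inner_eq:
  assumes "A \<in> carrier_mat m m" "B \<in> carrier_mat m m"
  shows "mat_inner A B = (\<Sum>i<m. \<Sum>j<m. A $$ (i, j) * B $$ (i, j))"
proof -
  have "mat_inner A B = (\<Sum>j<m. \<Sum>i<m. A $$ (i, j) * B $$ (i, j))"
    using assms by (simp add: mat_inner_def mat_trace_def scalar_prod_def atLeast0LessThan)
  also have "\<dots> = (\<Sum>i<m. \<Sum>j<m. A $$ (i, j) * B $$ (i, j))" by (rule sum.swap)
  finally show ?thesis .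
qed

lemma psd_mat_quadratic_nonneg:
  assumes "psd_mat m A"
  shows "(\<Sum>i<m. \<Sum>j<m. A $$ (i, j) * s i * s j) \<ge> 0"
proof -
  have A: "A \<in> carrier_mat m m" using assms by (simp add: psd_mat_def)
  have "scalar_prod (vec m s) (A *\<^sub>v vec m s) = (\<Sum>i<m. \<Sum>j<m. A $$ (i, j) * s i * s j)"
    using A by (simp add: scalar_prod_def atLeast0LessThan sum_distrib_left mult_ac)
  then show ?thesis using assms unfolding psd_mat_def by (metis vec_carrier)
qed

text \<open>The order of the arguments singles out w: x and y are the inner products with w, and z
  is that of the two remaining points.\<close>

definition triple_sum :: "'a::real_inner set \<Rightarrow> (real \<times> real \<times> real \<Rightarrow> real) \<Rightarrow> real" where
  "triple_sum C f = (\<Sum>u\<in>C. \<Sum>v\<in>C. \<Sum>w\<in>C. f (u \<bullet> w, v \<bullet> w, u \<bullet> v))"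

text \<open>Exchanging u and v exchanges x and y; exchanging v and w exchanges x and z. These two
  transpositions generate all permutations.\<close>

lemma triple_sum_permute:
  "triple_sum C (\<lambda>(x, y, z). f (x, z, y)) = triple_sum C f"
  "triple_sum C (\<lambda>(x, y, z). f (y, x, z)) = triple_sum C f"
  "triple_sum C (\<lambda>(x, y, z). f (y, z, x)) = triple_sum C f"
  "triple_sum C (\<lambda>(x, y, z). f (z, x, y)) = triple_sum C f"
  "triple_sum C (\<lambda>(x, y, z). f (z, y, x)) = triple_sum C f"
proof -
  have 1: "triple_sum C (\<lambda>(x, y, z). h (y, x, z)) = triple_sum C h" for h
    unfolding triple_sum_def by (subst sum.swap) (simp add: inner_commute)
  have 2: "triple_sum C (\<lambda>(x, y, z). h (z, y, x)) = triple_sum C h" for h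
  proof -
    have "triple_sum C h = (\<Sum>u\<in>C. \<Sum>w\<in>C. \<Sum>v\<in>C. h (u \<bullet> w, v \<bullet> w, u \<bullet> v))"
      unfolding triple_sum_def by (intro sum.cong refl sum.swap)
    then show ?thesis by (simp add: triple_sum_def inner_commute)
  qed
  show "triple_sum C (\<lambda>(x, y, z). f (y, x, z)) = triple_sum C f" by (rule 1)
  show "triple_sum C (\<lambda>(x, y, z). f (z, y, x)) = triple_sum C f" by (rule 2)
  show 3: "triple_sum C (\<lambda>(x, y, z). f (y, z, x)) = triple_sum C f"
    using 1[of "\<lambda>(x, y, z). f (x, z, y)"] 2[of "\<lambda>(x, y, z). f (y, x, z)"] 1[of f] by (simp add: case_prod_beta')
  show "triple_sum C (\<lambda>(x, y, z). f (z, x, y)) = triple_sum C f"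
    using 1[of "\<lambda>(x, y, z). f (z, y, x)"] 2[of f] by (simp add: case_prod_beta')
  show "triple_sum C (\<lambda>(x, y, z). f (x, z, y)) = triple_sum C f"
    using 1[of "\<lambda>(x, y, z). f (y, z, x)"] 3 by (simp add: case_prod_beta')
qed

lemma triple_sum_sum: "triple_sum C (\<lambda>p. \<Sum>k\<in>I. f k p) = (\<Sum>k\<in>I. triple_sum C (f k))"
proof -
  have "triple_sum C (\<lambda>p. \<Sum>k\<in>I. f k p) = (\<Sum>u\<in>C. \<Sum>v\<in>C. \<Sum>k\<in>I. \<Sum>w\<in>C. f k (u \<bullet> w, v \<bullet> w, u \<bullet> v))"
    unfolding triple_sum_def by (intro sum.cong refl sum.swap)
  also have "\<dots> = (\<Sum>u\<in>C. \<Sum>k\<in>I. \<Sum>v\<in>C. \<Sum>w\<in>C. f k (u \<bullet> w, v \<bullet> w, u \<bullet> v))"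
    by (intro sum.cong refl sum.swap)
  also have "\<dots> = (\<Sum>k\<in>I. triple_sum C (f k))"
    unfolding triple_sum_def by (rule sum.swap)
  finally show ?thesis .
qed

lemma triple_sum_add: "triple_sum C (\<lambda>p. f p + g p) = triple_sum C f + triple_sum C g"
  by (simp add: triple_sum_def sum.distrib)

lemma triple_sum_cmult: "triple_sum C (\<lambda>p. c * f p) = c * triple_sum C f"
  by (simp add: triple_sum_def sum_distrib_left)

text \<open>For fixed w the entry (i, j) is (u . w)^i (v . w)^j K(u, v), with K the zonal kernel of
  degree k on the hyperplane orthogonal to w. Hence \<open>psd_kernel_quadratic_nonneg\<close>
  applies with the powers of u . w, and every w contributes a nonnegative amount.\<close>

lemma triple_sum_Y_mat_nonneg:
  fixes C :: "'a::euclidean_space set"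
  assumes n: "n = DIM('a)" "n \<ge> 3" and C: "finite C" "C \<subseteq> sphere 0 1"
    and A: "psd_mat (d - k + 1) A"
  shows "triple_sum C (\<lambda>p. mat_inner A (Y_mat n d k p)) \<ge> 0"
proof -
  define m where "m = d - k + 1"
  have Ac: "A \<in> carrier_mat m m" using A by (simp add: psd_mat_def m_def)
  have "triple_sum C (\<lambda>p. mat_inner A (Y_mat n d k p)) =
    (\<Sum>w\<in>C. \<Sum>u\<in>C. \<Sum>v\<in>C. mat_inner A (Y_mat n d k (u \<bullet> w, v \<bullet> w, u \<bullet> v)))"
  proof -
    have "triple_sum C (\<lambda>p. mat_inner A (Y_mat n d k p)) =
      (\<Sum>u\<in>C. \<Sum>w\<in>C. \<Sum>v\<in>C. mat_inner A (Y_mat n d k (u \<bullet> w, v \<bullet> w, u \<bullet> v)))"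
      unfolding triple_sum_def by (intro sum.cong refl sum.swap)
    also have "\<dots> = (\<Sum>w\<in>C. \<Sum>u\<in>C. \<Sum>v\<in>C. mat_inner A (Y_mat n d k (u \<bullet> w, v \<bullet> w, u \<bullet> v)))"
      by (rule sum.swap)
    finally show ?thesis .
  qed
  also have "\<dots> \<ge> 0"
  proof (rule sum_nonneg)
    fix w assume "w \<in> C"
    then have "norm w = 1" using C by auto
    then obtain B where B: "orthonormal B" "card B = DIM('a) - 1"
      "\<And>u v. ip_on B u v = u \<bullet> v - (u \<bullet> w) * (v \<bullet> w)"
      using orthonormal_complement_basis by blast
    define K where "K u v = geg_hom (card B) k (ip_on B u v) (ip_on B u u * ip_on B v v)" for u v
    have psd: "psd_kernel K"
      unfolding K_def using B(2) n by (intro psd_kernel_geg_hom[OF B(1)]) simp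
    have eq: "mat_inner A (Y_mat n d k (u \<bullet> w, v \<bullet> w, u \<bullet> v)) =
        (\<Sum>i<m. \<Sum>j<m. A $$ (i, j) * ((u \<bullet> w) ^ i * (v \<bullet> w) ^ j)) * K u v"
      if "u \<in> C" "v \<in> C" for u v
    proof -
      have "u \<bullet> u = 1" "v \<bullet> v = 1" using that C by (auto simp: norm_eq_1)
      then have K: "K u v = geg_hom (n - 1) k (u \<bullet> v - (u \<bullet> w) * (v \<bullet> w)) ((1 - (u \<bullet> w)\<^sup>2) * (1 - (v \<bullet> w)\<^sup>2))"
        using n B(2) by (simp add: K_def B(3) power2_eq_square)
      have "mat_inner A (Y_mat n d k (u \<bullet> w, v \<bullet> w, u \<bullet> v)) =
        (\<Sum>i<m. \<Sum>j<m. A $$ (i, j) * Y_mat n d k (u \<bullet> w, v \<bullet> w, u \<bullet> v) $$ (i, j))"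
        by (rule mat_inner_eq[OF Ac]) (simp add: Y_mat_def m_def)
      also have "\<dots> = (\<Sum>i<m. \<Sum>j<m. A $$ (i, j) * ((u \<bullet> w) ^ i * (v \<bullet> w) ^ j) * K u v)"
        using n(2) by (intro sum.cong refl) (simp add: Y_mat_def m_def Y_entry_eq K)
      finally show ?thesis by (simp add: sum_distrib_right)
    qed
    have "(\<Sum>u\<in>C. \<Sum>v\<in>C. (\<Sum>i<m. \<Sum>j<m. A $$ (i, j) * ((u \<bullet> w) ^ i * (v \<bullet> w) ^ j)) * K u v) \<ge> 0"
      by (rule psd_kernel_quadratic_nonneg[OF psd C(1), where p = "\<lambda>i u. (u \<bullet> w) ^ i"])
        (rule psd_mat_quadratic_nonneg[OF A[folded m_def]])
    then show "(\<Sum>u\<in>C. \<Sum>v\<in>C. mat_inner A (Y_mat n d k (u \<bullet> w, v \<bullet> w, u \<bullet> v))) \<ge> 0"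
      by (simp add: eq cong: sum.cong)
  qed
  finally show ?thesis .
qed

text \<open>Averaging over the permutations of (x, y, z) is invisible to a sum over all ordered
  triples.\<close>

lemma triple_sum_S_mat:
  assumes A: "A \<in> carrier_mat (d - k + 1) (d - k + 1)"
  shows "triple_sum C (\<lambda>p. mat_inner A (S_mat n d k p)) = triple_sum C (\<lambda>p. mat_inner A (Y_mat n d k p))"
proof -
  define m where "m = d - k + 1"
  define f where "f p = mat_inner A (Y_mat n d k p)" for p
  have Yc: "Y_mat n d k p \<in> carrier_mat m m" for p by (simp add: Y_mat_def m_def)
  have Sc: "S_mat n d k p \<in> carrier_mat m m" for p
    by (cases p) (simp add: S_mat_def Y_mat_def m_def)
  have "mat_inner A (S_mat n d k (x, y, z)) =
      1 / 6 * (f (x, y, z) + f (x, z, y) + f (y, x, z) + f (y, z, x) + f (z, x, y) + f (z, y, x))" for x y z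
    unfolding f_def mat_inner_eq[OF A[folded m_def] Yc] mat_inner_eq[OF A[folded m_def] Sc]
    unfolding sum.distrib[symmetric] sum_distrib_left
    using Yc by (intro sum.cong refl) (simp add: S_mat_def Y_mat_def m_def algebra_simps)
  then have "(\<lambda>p. mat_inner A (S_mat n d k p)) = (\<lambda>p. 1 / 6 * (f p + (\<lambda>(x, y, z). f (x, z, y)) p
      + (\<lambda>(x, y, z). f (y, x, z)) p + (\<lambda>(x, y, z). f (y, z, x)) p + (\<lambda>(x, y, z). f (z, x, y)) p
      + (\<lambda>(x, y, z). f (z, y, x)) p))"
    by (auto simp: fun_eq_iff)
  then have "triple_sum C (\<lambda>p. mat_inner A (S_mat n d k p)) = triple_sum C f"
    by (simp only: triple_sum_cmult triple_sum_add triple_sum_permute) simp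
  then show ?thesis by (simp add: f_def [abs_def])
qed

text \<open>The terms with k > 0 are nonnegative. For k = 0 split M_0 = A + f0 E_0 with A positive
  semidefinite; the entry (0, 0) of the matrix for k = 0 is constantly 1, so the second part
  contributes f0 for each ordered triple.\<close>

lemma BV_triple_sum_ge:
  fixes C :: "'a::euclidean_space set"
  assumes n: "n = DIM('a)" "n \<ge> 3" and C: "finite C" "C \<subseteq> sphere 0 1" and F: "F \<in> BV n f0"
  shows "triple_sum C F \<ge> f0 * real (card C) ^ 3"
proof -
  obtain d M where M: "\<And>k. k \<le> d \<Longrightarrow> psd_mat (d - k + 1) (M k)"
    and M0: "psd_mat (d + 1) (M 0 - f0 \<cdot>\<^sub>m E0_mat (d + 1))"
    and F_eq: "\<And>p. F p = (\<Sum>k\<le>d. mat_inner (M k) (S_mat n d k p))"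
    using F unfolding BV_def by blast
  define L where "L k = triple_sum C (\<lambda>p. mat_inner (M k) (Y_mat n d k p))" for k
  have "triple_sum C F = (\<Sum>k\<le>d. triple_sum C (\<lambda>p. mat_inner (M k) (S_mat n d k p)))"
    unfolding F_eq by (rule triple_sum_sum)
  also have "\<dots> = (\<Sum>k\<le>d. L k)"
    unfolding L_def using M by (intro sum.cong refl triple_sum_S_mat) (auto simp: psd_mat_def)
  also have "\<dots> = L 0 + (\<Sum>k\<in>{..d} - {0}. L k)"
    by (rule sum.remove) auto
  also have "\<dots> \<ge> L 0"
    unfolding L_def using M by (auto intro!: sum_nonneg triple_sum_Y_mat_nonneg n C)
  finally have 1: "triple_sum C F \<ge> L 0" .
  define A where "A = M 0 - f0 \<cdot>\<^sub>m E0_mat (d + 1)"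
  have M0c: "M 0 \<in> carrier_mat (d + 1) (d + 1)" using M[of 0] by (simp add: psd_mat_def)
  have Ac: "A \<in> carrier_mat (d + 1) (d + 1)" using M0 by (simp add: psd_mat_def A_def)
  have "mat_inner (M 0) (Y_mat n d 0 p) = mat_inner A (Y_mat n d 0 p) + f0" for p
  proof -
    have Yc: "Y_mat n d 0 p \<in> carrier_mat (d + 1) (d + 1)" by (simp add: Y_mat_def)
    obtain x y z where p: "p = (x, y, z)" by (cases p)
    have Y00: "Y_mat n d 0 p $$ (0, 0) = 1"
      using n(2) by (simp add: p Y_mat_def Y_entry_eq geg_hom_def)
    have "mat_inner (M 0) (Y_mat n d 0 p) =
      (\<Sum>i<d+1. \<Sum>j<d+1. A $$ (i, j) * Y_mat n d 0 p $$ (i, j)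
        + (if j = 0 then if i = 0 then f0 * Y_mat n d 0 p $$ (0, 0) else 0 else 0))"
      unfolding mat_inner_eq[OF M0c Yc]
      using M0c by (intro sum.cong refl) (auto simp: A_def E0_mat_def algebra_simps)
    also have "\<dots> = mat_inner A (Y_mat n d 0 p) + f0 * Y_mat n d 0 p $$ (0, 0)"
      unfolding mat_inner_eq[OF Ac Yc] by (simp only: sum.distrib) simp
    finally show ?thesis by (simp add: Y00)
  qed
  then have "L 0 = triple_sum C (\<lambda>p. mat_inner A (Y_mat n d 0 p)) + triple_sum C (\<lambda>p. f0)"
    unfolding L_def by (simp add: triple_sum_add)
  moreover have "triple_sum C (\<lambda>p. mat_inner A (Y_mat n d 0 p)) \<ge> 0"
    using M0 by (intro triple_sum_Y_mat_nonneg n C) (simp add: A_def)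
  moreover have "triple_sum C (\<lambda>p. f0) = f0 * real (card C) ^ 3"
    by (simp add: triple_sum_def power3_eq_cube)
  ultimately show ?thesis using 1 by linarith
qed

section \<open>Counting pairs: parity and the distance distribution\<close>

lemma sum_symmetric_irreflexive_even:
  assumes "finite C" and sym: "\<And>u v. R u v \<longleftrightarrow> R v u" and irr: "\<And>u. u \<in> C \<Longrightarrow> \<not> R u u"
  shows "\<exists>k::nat. (\<Sum>u\<in>C. \<Sum>v\<in>C. of_bool (R u v)) = 2 * real k"
  using assms(1,3)
proof (induction C rule: finite_induct)
  case empty
  then show ?case by (auto intro: exI[of _ 0])
next
  case (insert c C)
  then obtain k :: nat where k: "(\<Sum>u\<in>C. \<Sum>v\<in>C. of_bool (R u v)) = 2 * real k" by auto
  \<comment> \<open>The new point adds a row and a column with l entries each, equal by symmetry,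
    and nothing on the diagonal.\<close>
  define l where "l = card {v \<in> C. R c v}"
  have l: "(\<Sum>v\<in>C. of_bool (R c v)) = real l"
    using insert.hyps(1) by (simp add: l_def of_bool_def sum.If_cases Int_def)
  moreover have "(\<Sum>u\<in>C. of_bool (R u c)) = real l"
    using l by (simp add: sym[of _ c])
  ultimately have "(\<Sum>u\<in>insert c C. \<Sum>v\<in>insert c C. of_bool (R u v)) = 2 * real (k + l)"
    using insert.prems insert.hyps k by (simp add: sum.distrib del: sum_of_bool_eq)
  then show ?case by blast
qed

text \<open>As T may be infinite, the sum is first moved to \<open>T'\<close>, the finite set of
  inner products of code points that lie in T; it contains every t in T with A_t > 0. Interchanging
  the sums then counts ordered pairs.\<close>

lemma dist_distr_sum_eq:
  assumes "finite C"
  shows "dist_distr_sum C T = (1 / real (card C)) * (\<Sum>u\<in>C. \<Sum>v\<in>C. of_bool (u \<bullet> v \<in> T))"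
proof -
  define T' where "T' = T \<inter> (\<lambda>(u, v). v \<bullet> u) ` (C \<times> C)"
  have fin: "finite T'" using assms by (simp add: T'_def)
  have nn: "dist_distr C t \<ge> 0" for t by (simp add: dist_distr_def sum_nonneg)
  have "{t \<in> T. dist_distr C t > 0} \<subseteq> T'"
  proof safe
    fix t assume t: "t \<in> T" "dist_distr C t > 0"
    have "\<exists>u\<in>C. {v \<in> C. v \<bullet> u = t} \<noteq> {}"
    proof (rule ccontr)
      assume "\<not> ?thesis"
      then have "dist_distr_at C u t = 0" if "u \<in> C" for u
        using that unfolding dist_distr_at_def by (metis card.empty)
      then have "dist_distr C t = 0" by (simp add: dist_distr_def)
      with t show False by simp
    qed
    with t show "t \<in> T'" by (force simp: T'_def)
  qed
  then have "dist_distr_sum C T = (\<Sum>t\<in>T'. dist_distr C t)"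
    unfolding dist_distr_sum_def using fin nn
    by (intro sum.mono_neutral_left) (auto simp: T'_def order_less_le)
  also have "\<dots> = (1 / real (card C)) * (\<Sum>t\<in>T'. \<Sum>u\<in>C. \<Sum>v\<in>C. of_bool (v \<bullet> u = t))"
    using assms by (simp add: dist_distr_def dist_distr_at_def sum_distrib_left of_bool_def sum.If_cases Int_def)
  also have "(\<Sum>t\<in>T'. \<Sum>u\<in>C. \<Sum>v\<in>C. of_bool (v \<bullet> u = t)) = (\<Sum>u\<in>C. \<Sum>t\<in>T'. \<Sum>v\<in>C. of_bool (v \<bullet> u = t) :: real)"
    by (rule sum.swap)
  also have "\<dots> = (\<Sum>u\<in>C. \<Sum>v\<in>C. \<Sum>t\<in>T'. of_bool (v \<bullet> u = t))"
    by (intro sum.cong refl sum.swap)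
  also have "\<dots> = (\<Sum>u\<in>C. \<Sum>v\<in>C. of_bool (u \<bullet> v \<in> T))"
  proof (intro sum.cong refl)
    fix u v assume "u \<in> C" "v \<in> C"
    then have "v \<bullet> u \<in> T' \<longleftrightarrow> u \<bullet> v \<in> T" by (force simp: T'_def inner_commute)
    with fin show "(\<Sum>t\<in>T'. of_bool (v \<bullet> u = t)) = (of_bool (u \<bullet> v \<in> T) :: real)"
      by (simp add: of_bool_def sum.delta')
  qed
  finally show ?thesis .
qed

section \<open>The upper bound for the sum over triples\<close>

lemma unit_gram_nonneg:
  fixes u v w :: "'a::real_inner"
  assumes "norm u = 1" "norm v = 1" "norm w = 1"
  shows "1 + 2 * (u \<bullet> w) * (v \<bullet> w) * (u \<bullet> v) - (u \<bullet> w)\<^sup>2 - (v \<bullet> w)\<^sup>2 - (u \<bullet> v)\<^sup>2 \<ge> 0"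
proof -
  let ?u = "u - (u \<bullet> w) *\<^sub>R w" and ?v = "v - (v \<bullet> w) *\<^sub>R w"
  have n: "u \<bullet> u = 1" "v \<bullet> v = 1" "w \<bullet> w = 1" using assms by (auto simp: norm_eq_1)
  \<comment> \<open>Cauchy-Schwarz for the components orthogonal to w; it states that the Gram
    determinant of u, v, w is nonnegative.\<close>
  have "(?u \<bullet> ?v)\<^sup>2 \<le> (?u \<bullet> ?u) * (?v \<bullet> ?v)" by (rule Cauchy_Schwarz_ineq)
  also have "?u \<bullet> ?v = u \<bullet> v - (u \<bullet> w) * (v \<bullet> w)"
    by (simp add: inner_diff_left inner_diff_right n inner_commute[of w u] inner_commute[of w v])
  also have "?u \<bullet> ?u = 1 - (u \<bullet> w)\<^sup>2"
    by (simp add: inner_diff_left inner_diff_right n inner_commute[of w u] inner_commute[of w v] power2_eq_square)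
  also have "?v \<bullet> ?v = 1 - (v \<bullet> w)\<^sup>2"
    by (simp add: inner_diff_left inner_diff_right n inner_commute[of w u] inner_commute[of w v] power2_eq_square)
  finally show ?thesis by (simp add: algebra_simps power2_eq_square)
qed

text \<open>Triples are sorted by coincidences: condition (3) covers three distinct points,
  condition (2) exactly two equal ones, and triples of equal points give F(1, 1, 1).\<close>

lemma F_class_triple_sum_le:
  fixes C :: "(real ^ 'n) set"
  assumes F: "F \<in> F_class n f0 T g B \<theta>" and C: "spherical_code N \<theta> C"
    and T: "T \<subseteq> {-1..cos \<theta>}" and \<theta>: "0 < \<theta>" "\<theta> \<le> pi"
  shows "triple_sum C F \<le> 3 * real N * (\<Sum>u\<in>C. \<Sum>v\<in>C. ext0 T g (u \<bullet> v))
     + 3 * real N * (real N - 1) * B + real N * F (1, 1, 1)"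
proof -
  define G where "G = ext0 T g"
  have C': "finite C" "card C = N" "\<And>u. u \<in> C \<Longrightarrow> norm u = 1"
    "\<And>u v. u \<in> C \<Longrightarrow> v \<in> C \<Longrightarrow> u \<noteq> v \<Longrightarrow> u \<bullet> v \<le> cos \<theta>"
    using C by (auto simp: spherical_code_def)
  have lower: "u \<bullet> v \<ge> -1" if "u \<in> C" "v \<in> C" for u v
    using Cauchy_Schwarz_ineq2[of u v] that C'(3) by auto
  have "cos \<theta> < 1" using cos_monotone_0_pi[of 0 \<theta>] \<theta> by simp
  then have G1: "G 1 = 0" using T by (auto simp: G_def ext0_def)
  have pair: "F (x, x, 1) \<le> B + 2 * G x" if "x \<in> {-1..cos \<theta>}" for x
    using F that unfolding F_class_def G_def by blast
  have triple: "F (x, y, z) \<le> G x + G y + G z" if "(x, y, z) \<in> D_dom \<theta>" for x y z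
    using F that unfolding F_class_def G_def by blast
  have "symmetric3 F" using F by (auto simp: F_class_def BV_def)
  then have sym: "F (x, 1, x) = F (x, x, 1)" "F (1, x, x) = F (x, x, 1)" for x
    unfolding symmetric3_def by metis+
  \<comment> \<open>One bound for all patterns. Each coincidence earns B; a triple of equal points
    earns it three times, which the last summand takes back. Since \<open>G 1 = 0\<close>, the inner
    product of a point with itself adds nothing.\<close>
  have "F (u \<bullet> w, v \<bullet> w, u \<bullet> v) \<le> G (u \<bullet> w) + G (v \<bullet> w) + G (u \<bullet> v)
      + (if w = v then B else 0) + (if w = u then B else 0) + (if v = u then B else 0)
      + (if v = u then if w = v then F (1, 1, 1) - 3 * B else 0 else 0)"
    if uvw: "u \<in> C" "v \<in> C" "w \<in> C" for u v w
  proof -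
    have n: "u \<bullet> u = 1" "v \<bullet> v = 1" "w \<bullet> w = 1" using uvw C'(3) by (auto simp: norm_eq_1)
    consider "u = v" "v = w" | "u = v" "v \<noteq> w" | "u = w" "v \<noteq> w" | "v = w" "u \<noteq> w"
      | "u \<noteq> v" "v \<noteq> w" "u \<noteq> w" by blast
    then show ?thesis
    proof cases
      case 1
      then show ?thesis using n by (simp add: G1)
    next
      case 2
      then have "u \<bullet> w \<in> {-1..cos \<theta>}" using uvw C'(4) lower by auto
      then show ?thesis using pair[of "u \<bullet> w"] 2 n by (simp add: G1)
    next
      case 3
      then have "v \<bullet> w \<in> {-1..cos \<theta>}" using uvw C'(4) lower by auto
      then show ?thesis using pair[of "v \<bullet> w"] 3 n by (simp add: G1 sym inner_commute)
    next
      case 4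
      then have "u \<bullet> w \<in> {-1..cos \<theta>}" using uvw C'(4) lower by auto
      then show ?thesis using pair[of "u \<bullet> w"] 4 n by (simp add: G1 sym)
    next
      case 5
      then have "(u \<bullet> w, v \<bullet> w, u \<bullet> v) \<in> D_dom \<theta>"
        using uvw C'(4) lower unit_gram_nonneg[OF C'(3) C'(3) C'(3), of u v w] by (simp add: D_dom_def)
      then show ?thesis using triple 5 by simp
    qed
  qed
  then have "triple_sum C F \<le> (\<Sum>u\<in>C. \<Sum>v\<in>C. \<Sum>w\<in>C. G (u \<bullet> w) + G (v \<bullet> w) + G (u \<bullet> v)
      + (if w = v then B else 0) + (if w = u then B else 0) + (if v = u then B else 0)
      + (if v = u then if w = v then F (1, 1, 1) - 3 * B else 0 else 0))"
    unfolding triple_sum_def by (intro sum_mono)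
  also have "\<dots> = 3 * real N * (\<Sum>u\<in>C. \<Sum>v\<in>C. G (u \<bullet> v)) + 3 * (real N)\<^sup>2 * B + real N * (F (1, 1, 1) - 3 * B)"
  proof -
    let ?S = "\<Sum>u\<in>C. \<Sum>v\<in>C. G (u \<bullet> v)"
    have "(\<Sum>u\<in>C. \<Sum>v\<in>C. \<Sum>w\<in>C. G (u \<bullet> w)) = real N * ?S"
      "(\<Sum>u\<in>C. \<Sum>v\<in>C. \<Sum>w\<in>C. G (v \<bullet> w)) = real N * ?S"
      "(\<Sum>u\<in>C. \<Sum>v\<in>C. \<Sum>w\<in>C. G (u \<bullet> v)) = real N * ?S"
      using C'(2) by (simp_all flip: sum_distrib_left)
    moreover have "(\<Sum>u\<in>C. \<Sum>v\<in>C. \<Sum>w\<in>C. if w = v then B else 0) = (real N)\<^sup>2 * B"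
      "(\<Sum>u\<in>C. \<Sum>v\<in>C. \<Sum>w\<in>C. if w = u then B else 0) = (real N)\<^sup>2 * B"
      "(\<Sum>u\<in>C. \<Sum>v\<in>C. \<Sum>w\<in>C. if v = u then B else 0) = (real N)\<^sup>2 * B"
      using C'(1,2) by (simp_all add: power2_eq_square flip: sum_distrib_left)
    moreover have "(\<Sum>u\<in>C. \<Sum>v\<in>C. \<Sum>w\<in>C. if v = u then if w = v then F (1, 1, 1) - 3 * B else 0 else 0)
      = real N * (F (1, 1, 1) - 3 * B)"
    proof -
      have "(\<Sum>w\<in>C. if v = u then if w = v then x else 0 else 0) = (if v = u then x else 0)"
        if "v \<in> C" for u v and x :: real
        using that C'(1) by auto
      then show ?thesis using C'(1,2) by simp
    qed
    ultimately show ?thesis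
      unfolding sum.distrib by (simp only:)
  qed
  also have "\<dots> = 3 * real N * (\<Sum>u\<in>C. \<Sum>v\<in>C. G (u \<bullet> v)) + 3 * real N * (real N - 1) * B + real N * F (1, 1, 1)"
    by (simp add: algebra_simps power2_eq_square)
  finally show ?thesis by (simp add: G_def)
qed

theorem corollary2:
  fixes \<theta> f0 B a :: real and T :: "real set" and g :: "real \<Rightarrow> real"
    and F :: "real \<times> real \<times> real \<Rightarrow> real"
    and N :: nat and C :: "(real ^ 'n) set"
  assumes "CARD('n) \<ge> 3"
    and "0 < \<theta>" and "\<theta> \<le> pi"
    and "f0 > 0"
    and "T \<subseteq> {-1..cos \<theta>}"
    and "F \<in> F_class CARD('n) f0 T g B \<theta>"
    and "a > 0" and "\<forall>t\<in>T. g t \<le> a"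
    and "spherical_code N \<theta> C"
  shows "dist_distr_sum C T \<ge>
    2 / real N * of_int \<lceil>(f0 * (real N)\<^sup>2 - F (1, 1, 1) - 3 * (real N - 1) * B) / (6 * a)\<rceil>"
proof -
  have C: "finite C" "card C = N" "N \<ge> 1" "C \<subseteq> sphere 0 1"
    using assms(9) by (auto simp: spherical_code_def)
  have T1: "1 \<notin> T" using assms(5) cos_monotone_0_pi[of 0 \<theta>] assms(2,3) by auto
  \<comment> \<open>Here k counts unordered pairs with inner product in T, so A(T) = 2 k / N. It
    remains to bound k below by R; k being an integer, the ceiling follows.\<close>
  have "\<exists>k::nat. (\<Sum>u\<in>C. \<Sum>v\<in>C. of_bool (u \<bullet> v \<in> T)) = 2 * real k"
  proof (rule sum_symmetric_irreflexive_even[OF C(1)])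
    fix u assume "u \<in> C"
    then have "u \<bullet> u = 1" using C(4) by (auto simp: norm_eq_1)
    then show "u \<bullet> u \<notin> T" using T1 by simp
  qed (simp add: inner_commute)
  then obtain k :: nat where k: "(\<Sum>u\<in>C. \<Sum>v\<in>C. of_bool (u \<bullet> v \<in> T)) = 2 * real k" ..
  have "f0 * real N ^ 3 \<le> triple_sum C F"
    using BV_triple_sum_ge[OF _ _ C(1,4), of "CARD('n)" F f0] assms(1,6) C(2)
    by (simp add: F_class_def)
  also have "\<dots> \<le> 3 * real N * (\<Sum>u\<in>C. \<Sum>v\<in>C. ext0 T g (u \<bullet> v))
     + 3 * real N * (real N - 1) * B + real N * F (1, 1, 1)"
    by (rule F_class_triple_sum_le[OF assms(6,9,5,2,3)])
  finally have 1: "f0 * real N ^ 3 \<le> \<dots>" .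
  have "(\<Sum>u\<in>C. \<Sum>v\<in>C. ext0 T g (u \<bullet> v)) \<le> (\<Sum>u\<in>C. \<Sum>v\<in>C. a * of_bool (u \<bullet> v \<in> T))"
    using assms(8) by (intro sum_mono) (auto simp: ext0_def)
  also have "\<dots> = a * (2 * real k)"
    by (simp only: k flip: sum_distrib_left)
  finally have "3 * real N * (\<Sum>u\<in>C. \<Sum>v\<in>C. ext0 T g (u \<bullet> v)) \<le> 3 * real N * (a * (2 * real k))"
    by (intro mult_left_mono) auto
  with 1 have "f0 * real N ^ 3 \<le> 3 * real N * (a * (2 * real k)) + 3 * real N * (real N - 1) * B + real N * F (1, 1, 1)"
    by linarith
  then have "real N * (f0 * (real N)\<^sup>2) \<le> real N * (6 * a * real k + 3 * (real N - 1) * B + F (1, 1, 1))"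
    by (simp add: algebra_simps power2_eq_square power3_eq_cube)
  then have "f0 * (real N)\<^sup>2 \<le> 6 * a * real k + 3 * (real N - 1) * B + F (1, 1, 1)"
    by (rule mult_left_le_imp_le) (use C(3) in simp)
  then have "f0 * (real N)\<^sup>2 - F (1, 1, 1) - 3 * (real N - 1) * B \<le> real k * (6 * a)"
    by (simp add: algebra_simps)
  then have "(f0 * (real N)\<^sup>2 - F (1, 1, 1) - 3 * (real N - 1) * B) / (6 * a) \<le> real k"
    using assms(7) by (simp add: pos_divide_le_eq)
  then have "\<lceil>(f0 * (real N)\<^sup>2 - F (1, 1, 1) - 3 * (real N - 1) * B) / (6 * a)\<rceil> \<le> int k"
    by (simp add: ceiling_le_iff)
  then have "real_of_int \<lceil>(f0 * (real N)\<^sup>2 - F (1, 1, 1) - 3 * (real N - 1) * B) / (6 * a)\<rceil> \<le> real k"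
    by linarith
  then have "2 / real N * real_of_int \<lceil>(f0 * (real N)\<^sup>2 - F (1, 1, 1) - 3 * (real N - 1) * B) / (6 * a)\<rceil>
      \<le> 2 / real N * real k"
    by (intro mult_left_mono) auto
  also have "\<dots> = dist_distr_sum C T"
    by (simp add: dist_distr_sum_eq[OF C(1)] C(2) k)
  finally show ?thesis .
qed

end
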